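(* Let $\mathfrak{g}$ be of type $A_{n-1}$, $B_n$, $C_n$, $D_n$ or $G_2$, with positive roots $R^+$ and set of simple roots $\Pi$. The partition $$\mathbb{B}(\infty)=\bigsqcup_{S\in\mathcal{ST}(\infty)}\mathbb{B}(S)$$ of the graph $\mathbb{B}(\infty)$ into its connected components, indexed by their source vertices, is a $t$-atomic decomposition of $B(\infty)$; in other words, $$\prod_{\alpha\in R^+}\frac{1}{1-te^{-\alpha}}=\sum_{\beta\in Q^+}M_t(\beta)\,e^{-\beta}\prod_{\alpha\in\Pi}\frac{1}{1-te^{-\alpha}},\qquad\text{where}\quad M_t(\beta)=\sum_{\substack{S\in\mathcal{ST}(\infty)\\ \mathrm{wt}(S)=-\beta}}t^{|S|}.$$
   Context: $Q^+$ is the $\mathbb{Z}_{\ge0}$-span of $\Pi=\{\alpha_1,\dots,\alpha_r\}$. The polynomials $M_t(\beta)$, $\beta\in Q^+$, are defined by $\prod_{\alpha\in R^+\setminus\Pi}\frac{1}{1-te^{-\alpha}}=\sum_{\beta\in Q^+}M_t(\beta)e^{-\beta}$. A multisegment is a finite multiset of positive roots, written as a formal sum $\sum_{\alpha\in R^+}m_\alpha\,\alpha$ with $m_\alpha\in\mathbb{Z}_{\ge0}$; $\mathfrak{M}$ is the set of multisegments. The crystal $B(\infty)$ of $\mathfrak{g}$ is realized (Hong-Lee) on the set $\mathcal{T}(\infty)$ of marginally large $\mathfrak{g}$-tableaux: $\mathfrak{g}$-tableaux with $d$ rows ($d=n$ in types $B_n,C_n$; $d=n-1$ in types $A_{n-1},D_n$;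 $d=2$ in type $G_2$) such that, for $i=1,\dots,d-1$, the number of boxes containing $i$ in row $i$ is $1$ plus the number of boxes in row $i+1$. There is a known bijection (Lee-Salisbury) $\Xi:\mathcal{T}(\infty)\to\mathfrak{M}$, compatible with weights: $\mathrm{wt}(T)=-\sum_\alpha m_\alpha\alpha$ if $\Xi(T)=\sum_\alpha m_\alpha\,\alpha$. For example, in type $A_{n-1}$, $m_{\varepsilon_i-\varepsilon_j}$ ($i<j$) is the number of letters $j$ in row $i$ of $T$. Put $|T|=\sum_{\alpha}m_\alpha$. For $i=1,\dots,r$, $\mathrm{F}_i(T)$ is the unique tableau $T'\in\mathcal{T}(\infty)$ with $\Xi(T')=\Xi(T)+\alpha_i$; $\mathrm{E}_i(T_1)=T_2$ if $\mathrm{F}_i(T_2)=T_1$, and $\mathrm{E}_i(T_1)=0$ if there is no such $T_2$. The directed graph $\mathbb{B}(\infty)$ has vertex set $\mathcal{T}(\infty)$ and edges $T\dashrightarrow\mathrm{F}_i(T)$. $\mathcal{ST}(\infty)$ is the set of source vertices, i.e. $T$ with $\mathrm{E}_i(T)=0$ for all $i$. Each connected component contains a unique source vertex $S$ and is denoted $\mathbb{B}(S)$. *)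

theory Defs
  imports
    "HOL-Library.Multiset"
    "HOL-Library.Poly_Mapping"
    "HOL-Library.Disjoint_Sets"
    "HOL-Computational_Algebra.Polynomial"
begin

section \<open>Formal power series with multisets as exponents\<close>

text \<open>A monomial in commuting variables indexed by \<^typ>\<open>'v\<close> is a finite multiset over \<^typ>\<open>'v\<close>;
  a multiset has only finitely many submultisets, so the Cauchy product is a finite sum.\<close>

typedef ('v, 'a) mseries = "UNIV :: ('v multiset \<Rightarrow> 'a) set"
  morphisms coeff_ms Abs_ms ..

lemma coeff_ms_Abs [simp]: "coeff_ms (Abs_ms f) = f"
  by (simp add: Abs_ms_inverse)

lemma mseries_eqI: "(\<And>m. coeff_ms f m = coeff_ms g m) \<Longrightarrow> f = g"
  by (metis coeff_ms_inject ext)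

lemma double_diff_mset: "k \<subseteq># m \<Longrightarrow> m - (m - k) = (k :: 'v multiset)"
  by (metis add_diff_cancel_right' subset_mset.add_diff_inverse)

lemma finite_submultisets: "finite {k. k \<subseteq># (m :: 'v multiset)}"
proof (induction m)
  case (add x m)
  have "{k. k \<subseteq># add_mset x m} \<subseteq> {k. k \<subseteq># m} \<union> add_mset x ` {k. k \<subseteq># m}"
  proof
    fix k assume "k \<in> {k. k \<subseteq># add_mset x m}"
    then have k: "k \<subseteq># add_mset x m" by simp
    show "k \<in> {k. k \<subseteq># m} \<union> add_mset x ` {k. k \<subseteq># m}"
    proof (cases "x \<in># k")
      case True
      then obtain k' where "k = add_mset x k'" by (meson multi_member_split)
      with k show ?thesis by auto
    next
      case False
      then show ?thesis
        using k by (metis UnI1 diff_single_trivial mem_Collect_eq subset_eq_diff_conv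
            add_mset_add_single)
    qed
  qed
  then show ?case
    using add by (meson finite_UnI finite_imageI finite_subset)
qed simp

instantiation mseries :: (type, comm_ring_1) comm_ring_1
begin

definition zero_mseries :: "('a, 'b) mseries" where
  "0 = Abs_ms (\<lambda>_. 0)"

definition one_mseries :: "('a, 'b) mseries" where
  "1 = Abs_ms (\<lambda>m. if m = {#} then 1 else 0)"

definition plus_mseries :: "('a, 'b) mseries \<Rightarrow> ('a, 'b) mseries \<Rightarrow> ('a, 'b) mseries" where
  "f + g = Abs_ms (\<lambda>m. coeff_ms f m + coeff_ms g m)"

definition minus_mseries :: "('a, 'b) mseries \<Rightarrow> ('a, 'b) mseries \<Rightarrow> ('a, 'b) mseries" where
  "f - g = Abs_ms (\<lambda>m. coeff_ms f m - coeff_ms g m)"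

definition uminus_mseries :: "('a, 'b) mseries \<Rightarrow> ('a, 'b) mseries" where
  "- f = Abs_ms (\<lambda>m. - coeff_ms f m)"

definition times_mseries :: "('a, 'b) mseries \<Rightarrow> ('a, 'b) mseries \<Rightarrow> ('a, 'b) mseries" where
  "f * g = Abs_ms (\<lambda>m. \<Sum>k | k \<subseteq># m. coeff_ms f k * coeff_ms g (m - k))"

lemma times_mseries_comm: "f * g = g * (f :: ('a, 'b) mseries)"
proof (rule mseries_eqI)
  fix m
  have "(\<Sum>k | k \<subseteq># m. coeff_ms f k * coeff_ms g (m - k))
      = (\<Sum>k | k \<subseteq># m. coeff_ms g k * coeff_ms f (m - k))"
    by (rule sum.reindex_bij_witness[where i = "\<lambda>k. m - k" and j = "\<lambda>k. m - k"])
      (auto simp: mult.commute double_diff_mset)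
  then show "coeff_ms (f * g) m = coeff_ms (g * f) m"
    by (simp add: times_mseries_def)
qed

lemma times_mseries_assoc: "(f * g) * h = f * (g * (h :: ('a, 'b) mseries))"
proof (rule mseries_eqI)
  fix m :: "'a multiset"
  let ?S = "SIGMA k:{k. k \<subseteq># m}. {j. j \<subseteq># k}"
  let ?S' = "SIGMA j:{j. j \<subseteq># m}. {i. i \<subseteq># m - j}"
  have "coeff_ms ((f * g) * h) m
      = (\<Sum>k | k \<subseteq># m. \<Sum>j | j \<subseteq># k. coeff_ms f j * coeff_ms g (k - j) * coeff_ms h (m - k))"
    by (simp add: times_mseries_def sum_distrib_right)
  also have "\<dots> = (\<Sum>(k, j)\<in>?S. coeff_ms f j * coeff_ms g (k - j) * coeff_ms h (m - k))"
    by (subst sum.Sigma) (auto simp: finite_submultisets)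
  also have "\<dots> = (\<Sum>(j, i)\<in>?S'. coeff_ms f j * (coeff_ms g i * coeff_ms h (m - j - i)))"
  proof (rule sum.reindex_bij_witness[where i = "\<lambda>(j, i). (j + i, j)" and j = "\<lambda>(k, j). (j, k - j)"])
    fix a assume "a \<in> ?S"
    then obtain k j where a: "a = (k, j)" "k \<subseteq># m" "j \<subseteq># k" by auto
    then have kj: "j + (k - j) = k" by simp
    show "(case (case a of (k, j) \<Rightarrow> (j, k - j)) of (j, i) \<Rightarrow> (j + i, j)) = a"
      using a kj by simp
    show "(case a of (k, j) \<Rightarrow> (j, k - j)) \<in> ?S'"
      using a by (auto intro: order_trans)
        (metis add.commute kj subset_eq_diff_conv subset_mset.add_diff_inverse subset_mset.order_trans
          subset_mset.le_diff_conv2)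
    have "m - k = m - j - (k - j)" using kj by (metis diff_diff_add)
    then show "(case (case a of (k, j) \<Rightarrow> (j, k - j)) of
        (j, i) \<Rightarrow> coeff_ms f j * (coeff_ms g i * coeff_ms h (m - j - i)))
      = (case a of (k, j) \<Rightarrow> coeff_ms f j * coeff_ms g (k - j) * coeff_ms h (m - k))"
      using a by (simp add: mult.assoc)
  next
    fix b assume "b \<in> ?S'"
    then obtain j i where b: "b = (j, i)" "j \<subseteq># m" "i \<subseteq># m - j" by auto
    then have "j + i \<subseteq># m"
      by (metis add.commute subset_mset.le_diff_conv2)
    then show "(case b of (j, i) \<Rightarrow> (j + i, j)) \<in> ?S" using b by auto
    show "(case (case b of (j, i) \<Rightarrow> (j + i, j)) of (k, j) \<Rightarrow> (j, k - j)) = b"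
      using b by simp
  qed
  also have "\<dots> = (\<Sum>j | j \<subseteq># m. \<Sum>i | i \<subseteq># m - j.
      coeff_ms f j * (coeff_ms g i * coeff_ms h (m - j - i)))"
    by (subst sum.Sigma) (auto simp: finite_submultisets)
  also have "\<dots> = coeff_ms (f * (g * h)) m"
    by (simp add: times_mseries_def sum_distrib_left)
  finally show "coeff_ms ((f * g) * h) m = coeff_ms (f * (g * h)) m" .
qed

instance
proof
  fix f g h :: "('a, 'b) mseries"
  show "f * g * h = f * (g * h)" by (rule times_mseries_assoc)
  show "f * g = g * f" by (rule times_mseries_comm)
  show "1 * f = f"
  proof (rule mseries_eqI)
    fix m
    have "(\<Sum>k | k \<subseteq># m. coeff_ms 1 k * coeff_ms f (m - k))
        = (\<Sum>k | k \<subseteq># m. if k = {#} then coeff_ms f m else 0)"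
      by (rule sum.cong) (auto simp: one_mseries_def)
    then show "coeff_ms (1 * f) m = coeff_ms f m"
      by (simp add: times_mseries_def finite_submultisets)
  qed
  show "(f + g) * h = f * h + g * h"
    by (rule mseries_eqI)
      (simp add: times_mseries_def plus_mseries_def distrib_right sum.distrib)
  show "f + g + h = f + (g + h)" "f + g = g + f" "0 + f = f" "- f + f = 0" "f - g = f + - g"
    by (rule mseries_eqI; simp add: plus_mseries_def zero_mseries_def uminus_mseries_def
        minus_mseries_def algebra_simps)+
  show "(0 :: ('a, 'b) mseries) \<noteq> 1"
  proof
    assume "(0 :: ('a, 'b) mseries) = 1"
    then have "coeff_ms (0 :: ('a, 'b) mseries) {#} = coeff_ms 1 {#}" by simp
    then show False by (simp add: zero_mseries_def one_mseries_def)
  qed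
qed

end

definition monomial_ms :: "'v multiset \<Rightarrow> 'a \<Rightarrow> ('v, 'a :: comm_ring_1) mseries" where
  "monomial_ms k c = Abs_ms (\<lambda>m. if m = k then c else 0)"

text \<open>An inverse in a commutative ring is unique if it exists; \<open>1 - t e\<^sup>-\<^sup>\<alpha>\<close> is a unit because
  its constant coefficient is \<open>1\<close>.\<close>

definition inverse_ms :: "('v, 'a :: comm_ring_1) mseries \<Rightarrow> ('v, 'a) mseries" where
  "inverse_ms f = (THE h. f * h = 1)"


section \<open>Root systems\<close>

text \<open>\<open>TypeA n\<close> stands for \<open>A\<^bsub>n-1\<^esub>\<close>, so that \<open>\<epsilon>\<^sub>1, \<dots>, \<epsilon>\<^sub>n\<close> are the coordinates in all classical
  types.\<close>

datatype lie_type = TypeA nat | TypeB nat | TypeC nat | TypeD nat | TypeG2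

fun valid_type :: "lie_type \<Rightarrow> bool" where
  "valid_type (TypeA n) \<longleftrightarrow> n \<ge> 2"
| "valid_type (TypeB n) \<longleftrightarrow> n \<ge> 2"
| "valid_type (TypeC n) \<longleftrightarrow> n \<ge> 2"
| "valid_type (TypeD n) \<longleftrightarrow> n \<ge> 3"
| "valid_type TypeG2 \<longleftrightarrow> True"

text \<open>The number of coordinates \<open>\<epsilon>\<^sub>1, \<epsilon>\<^sub>2, \<dots>\<close>, which is also the largest unbarred letter.\<close>

fun dim :: "lie_type \<Rightarrow> nat" where
  "dim (TypeA n) = n"
| "dim (TypeB n) = n"
| "dim (TypeC n) = n"
| "dim (TypeD n) = n"
| "dim TypeG2 = 3"

fun rank :: "lie_type \<Rightarrow> nat" where
  "rank (TypeA n) = n - 1"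
| "rank (TypeB n) = n"
| "rank (TypeC n) = n"
| "rank (TypeD n) = n"
| "rank TypeG2 = 2"

type_synonym weight = "nat \<Rightarrow>\<^sub>0 int"

abbreviation \<epsilon> :: "nat \<Rightarrow> weight" where
  "\<epsilon> i \<equiv> Poly_Mapping.single i 1"

text \<open>In type \<open>G\<^sub>2\<close> the root \<open>\<alpha>\<^sub>1\<close> is the short simple root.\<close>

fun simple_root :: "lie_type \<Rightarrow> nat \<Rightarrow> weight" where
  "simple_root (TypeA n) i = \<epsilon> i - \<epsilon> (i + 1)"
| "simple_root (TypeB n) i = (if i = n then \<epsilon> n else \<epsilon> i - \<epsilon> (i + 1))"
| "simple_root (TypeC n) i = (if i = n then \<epsilon> n + \<epsilon> n else \<epsilon> i - \<epsilon> (i + 1))"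
| "simple_root (TypeD n) i = (if i = n then \<epsilon> (n - 1) + \<epsilon> n else \<epsilon> i - \<epsilon> (i + 1))"
| "simple_root TypeG2 i = (if i = 1 then \<epsilon> 1 - \<epsilon> 2 else \<epsilon> 2 + \<epsilon> 3 - \<epsilon> 1 - \<epsilon> 1)"

definition simple_roots :: "lie_type \<Rightarrow> weight set" where
  "simple_roots g = simple_root g ` {1..rank g}"

fun pos_roots :: "lie_type \<Rightarrow> weight set" where
  "pos_roots (TypeA n) = {\<epsilon> i - \<epsilon> j | i j. 1 \<le> i \<and> i < j \<and> j \<le> n}"
| "pos_roots (TypeB n) = {\<epsilon> i - \<epsilon> j | i j. 1 \<le> i \<and> i < j \<and> j \<le> n}
     \<union> {\<epsilon> i + \<epsilon> j | i j. 1 \<le> i \<and> i < j \<and> j \<le> n} \<union> {\<epsilon> i | i. 1 \<le> i \<and> i \<le> n}"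
| "pos_roots (TypeC n) = {\<epsilon> i - \<epsilon> j | i j. 1 \<le> i \<and> i < j \<and> j \<le> n}
     \<union> {\<epsilon> i + \<epsilon> j | i j. 1 \<le> i \<and> i < j \<and> j \<le> n} \<union> {\<epsilon> i + \<epsilon> i | i. 1 \<le> i \<and> i \<le> n}"
| "pos_roots (TypeD n) = {\<epsilon> i - \<epsilon> j | i j. 1 \<le> i \<and> i < j \<and> j \<le> n}
     \<union> {\<epsilon> i + \<epsilon> j | i j. 1 \<le> i \<and> i < j \<and> j \<le> n}"
| "pos_roots TypeG2 = (let a = simple_root TypeG2 1; b = simple_root TypeG2 2
     in {a, b, a + b, a + a + b, a + a + a + b, a + a + a + b + b})"


section \<open>Marginally large tableaux\<close>

text \<open>\<open>Pos i\<close>, \<open>Zero\<close>, \<open>Bar i\<close> are the letters \<open>i\<close>, \<open>0\<close> and \<open>i\<close> with a bar.\<close>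

datatype letter = Pos nat | Zero | Bar nat

fun letters :: "lie_type \<Rightarrow> letter set" where
  "letters (TypeA n) = Pos ` {1..n}"
| "letters (TypeB n) = Pos ` {1..n} \<union> {Zero} \<union> Bar ` {1..n}"
| "letters (TypeC n) = Pos ` {1..n} \<union> Bar ` {1..n}"
| "letters (TypeD n) = Pos ` {1..n} \<union> Bar ` {1..n}"
| "letters TypeG2 = Pos ` {1..3} \<union> {Zero} \<union> Bar ` {1..3}"

fun letter_position :: "nat \<Rightarrow> letter \<Rightarrow> nat" where
  "letter_position n (Pos i) = i"
| "letter_position n Zero = n + 1"
| "letter_position n (Bar i) = 2 * n + 2 - i"

text \<open>The order of the letters is \<open>1 \<prec> \<dots> \<prec> n \<prec> 0 \<prec> n-bar \<prec> \<dots> \<prec> 1-bar\<close>,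
  restricted to the letters of the type, except that \<open>n\<close> and \<open>n-bar\<close> are incomparable in
  type \<open>D\<^sub>n\<close>.\<close>

definition letter_less :: "lie_type \<Rightarrow> letter \<Rightarrow> letter \<Rightarrow> bool" where
  "letter_less g x y \<longleftrightarrow> letter_position (dim g) x < letter_position (dim g) y
     \<and> \<not> (\<exists>n. g = TypeD n \<and> x = Pos n \<and> y = Bar n)"

definition letter_le :: "lie_type \<Rightarrow> letter \<Rightarrow> letter \<Rightarrow> bool" where
  "letter_le g x y \<longleftrightarrow> x = y \<or> letter_less g x y"

text \<open>Rows increase weakly with respect to this partial order, with the usual proviso that \<open>0\<close>
  occurs at most once in a row. In type \<open>D\<^sub>n\<close> a row thus cannot contain both \<open>n\<close> and
  \<open>n-bar\<close>.\<close>

definition row_increasing :: "lie_type \<Rightarrow> letter list \<Rightarrow> bool" where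
  "row_increasing g r \<longleftrightarrow> sorted_wrt (\<lambda>x y. letter_less g x y \<or> (x = y \<and> x \<noteq> Zero)) r"

text \<open>In a large tableau a column that ends in row \<open>i\<close> reads \<open>1, \<dots>, i-1, x\<close>. The
  Kashiwara--Nakashima conditions for such columns (in type \<open>G\<^sub>2\<close>: those of Kang and Misra)
  amount to the following bound on \<open>x\<close>, and their conditions on pairs of columns impose
  nothing more; this is the description of large tableaux by Hong and Lee.\<close>

fun row_bound :: "lie_type \<Rightarrow> nat \<Rightarrow> letter \<Rightarrow> bool" where
  "row_bound (TypeA n) i x \<longleftrightarrow> True"
| "row_bound (TypeB n) i x \<longleftrightarrow> letter_le (TypeB n) x (Bar i)"
| "row_bound (TypeC n) i x \<longleftrightarrow> letter_le (TypeC n) x (Bar i)"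
| "row_bound (TypeD n) i x \<longleftrightarrow> letter_le (TypeD n) x (Bar i)"
| "row_bound TypeG2 i x \<longleftrightarrow> (i = 2 \<longrightarrow> letter_le TypeG2 x (Pos 3))"

fun num_rows :: "lie_type \<Rightarrow> nat" where
  "num_rows (TypeA n) = n - 1"
| "num_rows (TypeB n) = n"
| "num_rows (TypeC n) = n"
| "num_rows (TypeD n) = n - 1"
| "num_rows TypeG2 = 2"

type_synonym tableau = "letter list list"

text \<open>The \<open>i\<close>-th row, for \<open>i \<ge> 1\<close>; it is empty below the last row.\<close>

definition row :: "tableau \<Rightarrow> nat \<Rightarrow> letter list" where
  "row T i = (if 1 \<le> i \<and> i \<le> length T then T ! (i - 1) else [])"

definition g_tableau :: "lie_type \<Rightarrow> tableau \<Rightarrow> bool" where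
  "g_tableau g T \<longleftrightarrow> length T = num_rows g
     \<and> (\<forall>i\<in>{1..num_rows g}. set (row T i) \<subseteq> letters g \<and> row_increasing g (row T i)
          \<and> (\<forall>x\<in>set (row T i). row_bound g i x))
     \<and> (\<forall>i\<in>{1..<num_rows g}. length (row T (i + 1)) \<le> length (row T i)
          \<and> (\<forall>c<length (row T (i + 1)). letter_less g (row T i ! c) (row T (i + 1) ! c)))"

text \<open>The condition is also imposed on the last row \<open>i = d\<close>, where it says that there is exactly
  one letter \<open>d\<close>: otherwise that number would be arbitrary and tableaux would not be
  determined by their multisegments.\<close>

definition T_inf :: "lie_type \<Rightarrow> tableau set" where
  "T_inf g = {T. g_tableau g T \<and>
     (\<forall>i\<in>{1..num_rows g}. count_list (row T i) (Pos i) = 1 + length (row T (i + 1)))}"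

text \<open>Weights of the letters in the vector representation (in type \<open>G\<^sub>2\<close>, of dimension \<open>7\<close>, with
  highest weight \<open>2\<alpha>\<^sub>1 + \<alpha>\<^sub>2\<close>).\<close>

fun pos_letter_weight :: "lie_type \<Rightarrow> nat \<Rightarrow> weight" where
  "pos_letter_weight TypeG2 i =
     (if i = 1 then \<epsilon> 3 - \<epsilon> 2 else if i = 2 then \<epsilon> 3 - \<epsilon> 1 else \<epsilon> 1 - \<epsilon> 2)"
| "pos_letter_weight g i = \<epsilon> i"

fun letter_weight :: "lie_type \<Rightarrow> letter \<Rightarrow> weight" where
  "letter_weight g (Pos i) = pos_letter_weight g i"
| "letter_weight g Zero = 0"
| "letter_weight g (Bar i) = - pos_letter_weight g i"

text \<open>The weight in \<open>B(\<infinity>)\<close> is the weight of the tableau minus that of the highest weight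
  tableau of the same shape, whose \<open>i\<close>-th row contains only the letter \<open>i\<close>.\<close>

definition wt :: "lie_type \<Rightarrow> tableau \<Rightarrow> weight" where
  "wt g T = (\<Sum>i=1..num_rows g. \<Sum>x\<leftarrow>row T i. letter_weight g x - letter_weight g (Pos i))"


section \<open>The Lee--Salisbury bijection\<close>

text \<open>A multisegment is a multiset of weights all of which are positive roots. A box \<open>x\<close> in row
  \<open>i\<close> contributes the root \<open>wt i - wt x\<close>, except that \<open>x = i\<close> contributes nothing and
  that \<open>x = i-bar\<close> contributes two roots in the types (\<open>B\<close>, \<open>D\<close> and \<open>G\<^sub>2\<close>) in which
  \<open>wt i - wt x = 2 wt i\<close> is not a root.\<close>

fun bar_roots :: "lie_type \<Rightarrow> nat \<Rightarrow> weight multiset" where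
  "bar_roots (TypeD n) i = {# \<epsilon> i - \<epsilon> n, \<epsilon> i + \<epsilon> n #}"
| "bar_roots (TypeC n) i = {# \<epsilon> i + \<epsilon> i #}"
| "bar_roots g i = {# pos_letter_weight g i, pos_letter_weight g i #}"

definition box_roots :: "lie_type \<Rightarrow> nat \<Rightarrow> letter \<Rightarrow> weight multiset" where
  "box_roots g i x =
     (if x = Pos i then {#}
      else if x = Bar i then bar_roots g i
      else {# letter_weight g (Pos i) - letter_weight g x #})"

definition \<Xi> :: "lie_type \<Rightarrow> tableau \<Rightarrow> weight multiset" where
  "\<Xi> g T = (\<Sum>i=1..num_rows g. \<Sum>x\<leftarrow>row T i. box_roots g i x)"

definition tab_size :: "lie_type \<Rightarrow> tableau \<Rightarrow> nat" where
  "tab_size g T = size (\<Xi> g T)"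


section \<open>The graph on marginally large tableaux\<close>

definition F :: "lie_type \<Rightarrow> nat \<Rightarrow> tableau \<Rightarrow> tableau" where
  "F g i T = (THE T'. T' \<in> T_inf g \<and> \<Xi> g T' = add_mset (simple_root g i) (\<Xi> g T))"

text \<open>The value \<open>None\<close> plays the role of \<open>0\<close>.\<close>

definition E :: "lie_type \<Rightarrow> nat \<Rightarrow> tableau \<Rightarrow> tableau option" where
  "E g i T = (if \<exists>T'\<in>T_inf g. F g i T' = T
              then Some (THE T'. T' \<in> T_inf g \<and> F g i T' = T) else None)"

definition B_edges :: "lie_type \<Rightarrow> (tableau \<times> tableau) set" where
  "B_edges g = {(T, F g i T) | T i. T \<in> T_inf g \<and> i \<in> {1..rank g}}"

definition ST_inf :: "lie_type \<Rightarrow> tableau set" where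
  "ST_inf g = {T \<in> T_inf g. \<forall>i\<in>{1..rank g}. E g i T = None}"

definition B_connected :: "lie_type \<Rightarrow> (tableau \<times> tableau) set" where
  "B_connected g = (B_edges g \<union> (B_edges g)\<inverse>)\<^sup>* \<inter> T_inf g \<times> T_inf g"

definition B_components :: "lie_type \<Rightarrow> tableau set set" where
  "B_components g = T_inf g // B_connected g"

definition B_component :: "lie_type \<Rightarrow> tableau \<Rightarrow> tableau set" where
  "B_component g S = B_connected g `` {S}"


section \<open>Characters\<close>

text \<open>Since the simple roots are linearly independent, their nonnegative span is the free
  commutative monoid on them, that is, the monoid of multisets of simple roots; the weight
  given by such a multiset is its sum. Series in the \<open>e\<^sup>-\<^sup>\<beta>\<close> are power series with these
  exponents and with coefficients in the ring of integer polynomials in \<open>t\<close>.\<close>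

definition Q_plus :: "lie_type \<Rightarrow> weight multiset set" where
  "Q_plus g = {\<beta>. set_mset \<beta> \<subseteq> simple_roots g}"

type_synonym char_series = "(weight, int poly) mseries"

text \<open>The element \<open>e\<^sup>-\<^sup>v\<close> for a weight \<open>v\<close> in the nonnegative span of the simple roots.\<close>

definition exp_neg :: "lie_type \<Rightarrow> weight \<Rightarrow> char_series" where
  "exp_neg g v = monomial_ms (THE \<beta>. \<beta> \<in> Q_plus g \<and> \<Sum>\<^sub># \<beta> = v) 1"

definition t_series :: char_series where
  "t_series = monomial_ms {#} [:0, 1:]"

text \<open>The series \<open>\<Sum>\<^bsub>\<beta>\<^esub> c(\<beta>) e\<^sup>-\<^sup>\<beta>\<close>.\<close>

definition Q_plus_series :: "lie_type \<Rightarrow> (weight multiset \<Rightarrow> int poly) \<Rightarrow> char_series" where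
  "Q_plus_series g c = Abs_ms (\<lambda>\<beta>. if \<beta> \<in> Q_plus g then c \<beta> else 0)"

text \<open>The product of \<open>1 / (1 - t e\<^sup>-\<^sup>\<alpha>)\<close> over a set of positive roots.\<close>

definition t_product :: "lie_type \<Rightarrow> weight set \<Rightarrow> char_series" where
  "t_product g R = (\<Prod>\<alpha>\<in>R. inverse_ms (1 - t_series * exp_neg g \<alpha>))"

definition M_t :: "lie_type \<Rightarrow> weight multiset \<Rightarrow> int poly" where
  "M_t g \<beta> = coeff_ms (t_product g (pos_roots g - simple_roots g)) \<beta>"

text \<open>The sum of \<open>t\<^bsup>|T|\<^esup>\<close> over the tableaux of weight \<open>-\<beta>\<close> in \<open>X\<close>, and the
  \<open>t\<close>-character \<open>\<Sum>\<^bsub>T \<in> X\<^esub> t\<^bsup>|T|\<^esup> e\<^bsup>wt(T)\<^esup>\<close> of \<open>X\<close>. There are only finitely many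
  tableaux of a given weight.\<close>

definition t_mult :: "lie_type \<Rightarrow> tableau set \<Rightarrow> weight multiset \<Rightarrow> int poly" where
  "t_mult g X \<beta> = (\<Sum>T | T \<in> X \<and> wt g T = - \<Sum>\<^sub># \<beta>. [:0, 1:] ^ tab_size g T)"

definition t_character :: "lie_type \<Rightarrow> tableau set \<Rightarrow> char_series" where
  "t_character g X = Q_plus_series g (t_mult g X)"

end

theory Submission
  imports Defs
begin

text \<open>
  By the bijection \<open>\<Xi>\<close> a marginally large tableau is the same thing as a
  multisegment \<open>m\<close>, and the operators \<open>F\<^sub>i\<close> and \<open>E\<^sub>i\<close> merely add or remove one copy of a simple root.
  Hence a walk in the graph never changes the part of \<open>m\<close> supported on the nonsimple positive
  roots (the function \<open>core\<close> below), and it can change the simple part at will. So the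
  connected components are the fibres of \<open>core\<close>, the source of a component is its unique element
  without simple roots, and the component of \<open>S\<close> consists of the multisegments \<open>\<Xi> S + m\<close> where
  \<open>m\<close> ranges over all multisets of simple roots (\<open>B_connected_iff\<close>, \<open>ST_inf_iff\<close>,
  \<open>Xi_image_B_component\<close>).

  On the side of characters, expanding geometric series identifies the product of
  \<open>1 / (1 - t e\<^sup>-\<^sup>\<alpha>)\<close> over a set \<open>R\<close> of positive roots with the generating series of all
  multisets over \<open>R\<close>, where \<open>t\<close> records the size and \<open>e\<close> the sum
  (\<open>prod_inverse_eq_multiset_series\<close>). For the simple roots this is the character of a component up
  to the shift by its source. For the nonsimple positive roots, \<open>R\<close>-multisets are the sources, and this
  gives \<open>M\<^sub>t\<close>.

  Two facts about the individual types feed into this. The first one is that \<open>\<Xi>\<close> is a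
  bijection onto multisegments (\<open>bij_betw_Xi\<close>). In row \<open>i\<close>, every letter other than \<open>i\<close> and
  \<open>i-bar\<close> contributes one positive root, and the pairs of a row and such a letter correspond
  exactly to the positive roots (\<open>inj_box_root\<close>,
  \<open>pos_roots_eq_box_roots\<close>); type \<open>C\<close> differs only in
  that \<open>i-bar\<close> is one of these letters too. In the types \<open>B\<close>, \<open>D\<close> and \<open>G\<^sub>2\<close> the letter
  \<open>i-bar\<close> contributes the same two roots as a certain pair of letters, which is \<open>n, n-bar\<close> in
  type \<open>D\<close> and \<open>0, 0\<close> in the other two types. This is precisely the pair that a row must not
  contain, so that reading off a row from its roots is a division with remainder of multisets by
  that pair, whose quotient is the number of letters \<open>i-bar\<close> (\<open>expansion_bijective\<close>). The second
  one is that every positive root is a nonnegative combination of simple roots in a unique way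
  (\<open>pos_roots_subset_root_cone\<close>, \<open>Q_plus_sum_inj\<close>), so that the series may be compared coefficientwise in \<open>Q\<^sup>+\<close>.
\<close>


section \<open>Generating series of sets of multisets\<close>

text \<open>The set \<open>X\<close> is arbitrary because not only products of geometric series are of this form, where
  \<open>X\<close> consists of all multisets over a set of roots, but also the characters of components, where
  it is a translate of such a set.\<close>

definition multiset_series :: "('r \<Rightarrow> weight multiset) \<Rightarrow> 'r multiset set \<Rightarrow> char_series" where
  "multiset_series e X =
     Abs_ms (\<lambda>\<beta>. \<Sum>m | m \<in> X \<and> \<Sum>\<^sub># (image_mset e m) = \<beta>. [:0, 1:] ^ size m)"

lemma coeff_multiset_series:
  "coeff_ms (multiset_series e X) \<beta> =
     (\<Sum>m | m \<in> X \<and> \<Sum>\<^sub># (image_mset e m) = \<beta>. [:0, 1:] ^ size m)"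
  by (simp add: multiset_series_def)

lemma coeff_monomial_ms_times:
  "coeff_ms (monomial_ms k c * f) m = (if k \<subseteq># m then c * coeff_ms f (m - k) else 0)"
proof -
  have "coeff_ms (monomial_ms k c * f) m
      = (\<Sum>j | j \<subseteq># m. if j = k then c * coeff_ms f (m - k) else 0)"
    by (auto simp: times_mseries_def monomial_ms_def intro: sum.cong)
  then show ?thesis
    by (simp add: sum.delta[OF finite_submultisets])
qed

lemma monomial_ms_times_monomial_ms:
  "monomial_ms k c * monomial_ms l d = monomial_ms (k + l) (c * d)"
proof (rule mseries_eqI)
  fix m
  have "k \<subseteq># m \<and> m - k = l \<longleftrightarrow> m = k + l" by auto
  then show "coeff_ms (monomial_ms k c * monomial_ms l d) m = coeff_ms (monomial_ms (k + l) (c * d)) m"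
    by (auto simp: coeff_monomial_ms_times) (auto simp: monomial_ms_def)
qed

lemma t_series_power: "t_series ^ k = monomial_ms {#} ([:0, 1:] ^ k)"
proof (induction k)
  case 0
  show ?case by (simp add: one_mseries_def monomial_ms_def)
next
  case (Suc k)
  show ?case unfolding power_Suc Suc
    by (simp add: t_series_def monomial_ms_times_monomial_ms)
qed

text \<open>Size and exponent are additive in the multiset, so translating a set of multisets multiplies its
  series by a monomial. This is used both for a single root, in the recursion below, and for the
  multisegment of a source.\<close>

lemma multiset_series_shift:
  "multiset_series e ((+) a ` X) =
     monomial_ms (\<Sum>\<^sub># (image_mset e a)) ([:0, 1:] ^ size a) * multiset_series e X"
proof (rule mseries_eqI)
  fix \<beta>
  let ?\<psi> = "\<lambda>m. \<Sum>\<^sub># (image_mset e m)"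
  have fib: "{m \<in> (+) a ` X. ?\<psi> m = \<beta>} =
      (if ?\<psi> a \<subseteq># \<beta> then (+) a ` {m \<in> X. ?\<psi> m = \<beta> - ?\<psi> a} else {})"
  proof -
    have "?\<psi> (a + m) = \<beta> \<longleftrightarrow> ?\<psi> a \<subseteq># \<beta> \<and> ?\<psi> m = \<beta> - ?\<psi> a" for m
      by auto
    then show ?thesis by auto
  qed
  show "coeff_ms (multiset_series e ((+) a ` X)) \<beta> =
      coeff_ms (monomial_ms (?\<psi> a) ([:0, 1:] ^ size a) * multiset_series e X) \<beta>"
    unfolding coeff_multiset_series coeff_monomial_ms_times fib
    by (simp add: sum.reindex power_add sum_distrib_left)
qed

lemma size_le_size_sum_image_mset:
  assumes "\<And>r. r \<in># m \<Longrightarrow> e r \<noteq> {#}"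
  shows "size m \<le> size (\<Sum>\<^sub># (image_mset e m))"
  using assms
proof (induction m)
  case (add x m)
  have "size (e x) \<noteq> 0" using add.prems by simp
  then have "1 \<le> size (e x)" by linarith
  moreover have "size m \<le> size (\<Sum>\<^sub># (image_mset e m))" using add by simp
  ultimately show ?case by simp
qed simp

text \<open>Each element contributes a nonempty exponent, so the size of the multiset is at most that of the
  exponent. Without this finiteness the sums in \<open>multiset_series\<close> could degenerate to \<open>0\<close>.\<close>

lemma finite_multisets_of_sum:
  assumes "finite R" "\<And>r. r \<in> R \<Longrightarrow> e r \<noteq> {#}"
  shows "finite {m. set_mset m \<subseteq> R \<and> \<Sum>\<^sub># (image_mset e m) = \<beta>}"
proof (rule finite_subset)
  show "{m. set_mset m \<subseteq> R \<and> \<Sum>\<^sub># (image_mset e m) = \<beta>}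
      \<subseteq> mset ` {xs. set xs \<subseteq> R \<and> length xs \<le> size \<beta>}"
  proof
    fix m assume m: "m \<in> {m. set_mset m \<subseteq> R \<and> \<Sum>\<^sub># (image_mset e m) = \<beta>}"
    then have "size m \<le> size \<beta>"
      using size_le_size_sum_image_mset[of m e] assms(2) by auto
    moreover obtain xs where "m = mset xs" by (metis ex_mset)
    ultimately show "m \<in> mset ` {xs. set xs \<subseteq> R \<and> length xs \<le> size \<beta>}"
      using m by auto
  qed
  show "finite (mset ` {xs. set xs \<subseteq> R \<and> length xs \<le> size \<beta>})"
    using assms(1) by (simp add: finite_lists_length_le)
qed

text \<open>The expansion of one geometric series: a multiset over \<open>insert a R\<close> either avoids \<open>a\<close> or is
  obtained by adding one \<open>a\<close> to another such multiset.\<close>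

lemma multiset_series_insert:
  assumes "finite R" "\<And>r. r \<in> insert a R \<Longrightarrow> e r \<noteq> {#}" "a \<notin> R"
  shows "(1 - monomial_ms (e a) [:0, 1:]) * multiset_series e {m. set_mset m \<subseteq> insert a R} =
     multiset_series e {m. set_mset m \<subseteq> R}"
proof -
  let ?Y = "{m. set_mset m \<subseteq> insert a R}" and ?X = "{m. set_mset m \<subseteq> R}"
  let ?\<psi> = "\<lambda>m. \<Sum>\<^sub># (image_mset e m)"
  have split: "?Y = ?X \<union> (+) {#a#} ` ?Y"
  proof -
    have "m \<in> (+) {#a#} ` ?Y" if "set_mset m \<subseteq> insert a R" "\<not> set_mset m \<subseteq> R" for m
    proof -
      have "a \<in># m" using that by auto
      then obtain m' where "m = add_mset a m'" by (meson multi_member_split)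
      then show ?thesis using that by auto
    qed
    then show ?thesis by auto
  qed
  have "multiset_series e ?Y = multiset_series e ?X + multiset_series e ((+) {#a#} ` ?Y)"
  proof (rule mseries_eqI)
    fix \<beta>
    have fin: "finite {m \<in> ?Y. ?\<psi> m = \<beta>}"
      using finite_multisets_of_sum[of "insert a R" e \<beta>] assms by simp
    have "{m \<in> ?Y. ?\<psi> m = \<beta>} = {m \<in> ?X. ?\<psi> m = \<beta>} \<union> {m \<in> (+) {#a#} ` ?Y. ?\<psi> m = \<beta>}"
      by (subst split) auto
    moreover have "{m \<in> ?X. ?\<psi> m = \<beta>} \<inter> {m \<in> (+) {#a#} ` ?Y. ?\<psi> m = \<beta>} = {}"
      using assms(3) by auto
    ultimately show "coeff_ms (multiset_series e ?Y) \<beta> =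
        coeff_ms (multiset_series e ?X + multiset_series e ((+) {#a#} ` ?Y)) \<beta>"
      using fin by (simp add: coeff_multiset_series plus_mseries_def sum.union_disjoint)
  qed
  also have "\<dots> = multiset_series e ?X + monomial_ms (e a) [:0, 1:] * multiset_series e ?Y"
    by (simp only: multiset_series_shift) simp
  finally show ?thesis by (simp add: algebra_simps)
qed

lemma multiset_series_empty: "multiset_series e {m. set_mset m \<subseteq> {}} = 1"
  by (rule mseries_eqI) (auto simp: coeff_multiset_series one_mseries_def Collect_conv_if)

lemma inverse_ms_eq: "f * h = 1 \<Longrightarrow> inverse_ms f = h"
  unfolding inverse_ms_def
proof (rule the_equality)
  fix h' assume "f * h = 1" and *: "f * h' = 1"
  have "h' = (f * h) * h'" using \<open>f * h = 1\<close> by simp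
  also have "\<dots> = h * (f * h')" by (simp only: ac_simps)
  finally show "h' = h" using * by simp
qed

lemma prod_inverse_eq_multiset_series:
  assumes "finite R" "\<And>r. r \<in> R \<Longrightarrow> e r \<noteq> {#}"
  shows "(\<Prod>r\<in>R. inverse_ms (1 - monomial_ms (e r) [:0, 1:])) =
    multiset_series e {m. set_mset m \<subseteq> R}"
  using assms
proof (induction R rule: finite_induct)
  case empty
  show ?case using multiset_series_empty[of e] by simp
next
  case (insert a R)
  let ?f = "1 - monomial_ms (e a) [:0, 1:] :: char_series"
  let ?h = "inverse_ms ?f"
  have unit: "?f * multiset_series e {m. set_mset m \<subseteq> {a}} = 1"
    using multiset_series_insert[of "{}" a e] multiset_series_empty[of e] insert.prems by simp
  have inv: "?f * ?h = 1"
    unfolding inverse_ms_eq[OF unit] by (rule unit)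
  have "(\<Prod>r\<in>insert a R. inverse_ms (1 - monomial_ms (e r) [:0, 1:])) =
      ?h * multiset_series e {m. set_mset m \<subseteq> R}"
    using insert by simp
  also have "multiset_series e {m. set_mset m \<subseteq> R} = ?f * multiset_series e {m. set_mset m \<subseteq> insert a R}"
    using insert by (intro multiset_series_insert[symmetric]) auto
  also have "?h * \<dots> = (?f * ?h) * multiset_series e {m. set_mset m \<subseteq> insert a R}"
    by (simp only: ac_simps)
  also have "\<dots> = multiset_series e {m. set_mset m \<subseteq> insert a R}"
    unfolding inv by (rule mult_1)
  finally show ?case .
qed


section \<open>Division with remainder for multisets\<close>

text \<open>Subtract \<open>D\<close> as long as it is contained in the multiset.\<close>

lemma multiset_division_exists:
  assumes "D \<noteq> {#}"
  shows "\<exists>M k. \<not> D \<subseteq># M \<and> N = M + repeat_mset k D"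
proof (induction "size N" arbitrary: N rule: less_induct)
  case less
  show ?case
  proof (cases "D \<subseteq># N")
    case True
    then obtain N' where N: "N = D + N'" by (metis subset_mset.le_iff_add)
    moreover have "size D > 0" using assms by (simp add: nonempty_has_size)
    ultimately have "size N' < size N" by simp
    then obtain M k where "\<not> D \<subseteq># M" "N' = M + repeat_mset k D" using less by blast
    with N have "N = M + repeat_mset (Suc k) D" by (simp add: ac_simps)
    with \<open>\<not> D \<subseteq># M\<close> show ?thesis by blast
  next
    case False
    then have "N = N + repeat_mset 0 D" by simp
    with False show ?thesis by blast
  qed
qed

lemma multiset_division_unique:
  assumes "\<not> D \<subseteq># M" "\<not> D \<subseteq># M'"
    and eq: "M + repeat_mset k D = M' + repeat_mset k' D"
  shows "M = M' \<and> k = k'"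
proof -
  have aux: "i \<le> j" if "\<not> D \<subseteq># A" "A + repeat_mset j D = B + repeat_mset i D" for A B i j
  proof (rule ccontr)
    assume "\<not> i \<le> j"
    then obtain d where d: "i = Suc d + j" by (metis add_Suc less_iff_Suc_add not_le add.commute)
    have "A + repeat_mset j D = (B + repeat_mset (Suc d) D) + repeat_mset j D"
      using that(2) unfolding d repeat_mset_distrib by (simp only: add.assoc)
    then have "A = D + (B + repeat_mset d D)"
      unfolding add_right_cancel by (simp add: ac_simps)
    with that(1) show False by simp
  qed
  have "k = k'" using aux[of M k M' k'] aux[of M' k' M k] assms by (metis le_antisym)
  with eq show ?thesis by simp
qed

lemma image_mset_inj_on:
  assumes "inj_on f A" "set_mset M \<subseteq> A" "set_mset N \<subseteq> A" "image_mset f M = image_mset f N"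
  shows "M = N"
proof -
  have "image_mset (inv_into A f) (image_mset f K) = K" if "set_mset K \<subseteq> A" for K
  proof -
    have "image_mset (inv_into A f) (image_mset f K) = image_mset (\<lambda>x. x) K"
      unfolding image_mset.compositionality o_def
      using assms(1) that by (intro image_mset_cong) (auto intro: inv_into_f_f)
    then show ?thesis by simp
  qed
  then show ?thesis using assms by metis
qed

lemma ex_image_mset:
  assumes "set_mset N \<subseteq> f ` A"
  shows "\<exists>M. set_mset M \<subseteq> A \<and> image_mset f M = N"
proof -
  have "image_mset f (image_mset (inv_into A f) N) = image_mset (\<lambda>x. x) N"
    unfolding image_mset.compositionality o_def
    using assms by (intro image_mset_cong) (auto intro: f_inv_into_f)
  moreover have "set_mset (image_mset (inv_into A f) N) \<subseteq> A"
    using assms by (auto intro: inv_into_into)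
  ultimately show ?thesis unfolding multiset.map_ident by blast
qed

lemma sum_image_mset_singletons: "\<Sum>\<^sub># (image_mset (\<lambda>x. {#f x#}) M) = image_mset f M"
  by (induction M) auto

lemma sum_image_mset_replicate:
  "\<Sum>\<^sub># (image_mset h (replicate_mset k b)) = repeat_mset k (h b)" for h :: "_ \<Rightarrow> _ multiset"
  by (induction k) auto

text \<open>All letters of \<open>L\<close> stand for single roots, while \<open>b\<close> is shorthand for the multiset of letters
  \<open>D\<close>. Writing a multiset of roots with as many \<open>b\<close> as possible makes the encoding unique, and
  the number of \<open>b\<close> and the rest are the quotient and the remainder under division by \<open>D\<close>.\<close>

lemma expansion_bijective:
  assumes r: "inj_on r L" and box: "\<And>x. x \<in> L \<Longrightarrow> box x = {#r x#}"
    and b: "b \<notin> L" and D: "D \<noteq> {#}" "set_mset D \<subseteq> L" and boxb: "box b = image_mset r D"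
    and N: "set_mset N \<subseteq> r ` L"
  shows "\<exists>!M. set_mset M \<subseteq> insert b L \<and> \<not> D \<subseteq># M \<and> \<Sum>\<^sub># (image_mset box M) = N"
proof -
  have expand: "\<Sum>\<^sub># (image_mset box (M0 + replicate_mset k b)) = image_mset r (M0 + repeat_mset k D)"
    if "set_mset M0 \<subseteq> L" for M0 k
  proof -
    have "image_mset box M0 = image_mset (\<lambda>x. {#r x#}) M0"
      using that box by (intro image_mset_cong) auto
    moreover have "repeat_mset k (image_mset r D) = image_mset r (repeat_mset k D)"
      by (induction k) auto
    ultimately show ?thesis
      by (simp add: sum_image_mset_singletons sum_image_mset_replicate boxb
          del: image_replicate_mset)
  qed
  have rem: "D \<subseteq># M0 + replicate_mset k b \<longleftrightarrow> D \<subseteq># M0" if "set_mset M0 \<subseteq> L" for M0 k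
  proof -
    have "count D b = 0" using b D(2) by (meson count_eq_zero_iff subsetD)
    then show ?thesis
      unfolding subseteq_mset_def by (metis add_0_right count_replicate_mset count_union le0)
  qed
  have split: "\<exists>M0 k. set_mset M0 \<subseteq> L \<and> M = M0 + replicate_mset k b"
    if "set_mset M \<subseteq> insert b L" for M
  proof (intro exI conjI)
    show "M = filter_mset (\<lambda>x. x \<noteq> b) M + replicate_mset (count M b) b"
      by (rule multiset_eqI) auto
    show "set_mset (filter_mset (\<lambda>x. x \<noteq> b) M) \<subseteq> L" using that by auto
  qed
  have setD: "set_mset (repeat_mset k D) \<subseteq> L" for k
    using D(2) by (induction k) auto
  obtain N' where N': "set_mset N' \<subseteq> L" "image_mset r N' = N"
    using ex_image_mset[OF N] by blast
  obtain M0 k where M0: "\<not> D \<subseteq># M0" "N' = M0 + repeat_mset k D"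
    using multiset_division_exists[OF D(1)] by metis
  then have M0L: "set_mset M0 \<subseteq> L" using N'(1) by auto
  show ?thesis
  proof (rule ex1I[of _ "M0 + replicate_mset k b"])
    show "set_mset (M0 + replicate_mset k b) \<subseteq> insert b L \<and> \<not> D \<subseteq># M0 + replicate_mset k b
        \<and> \<Sum>\<^sub># (image_mset box (M0 + replicate_mset k b)) = N"
      unfolding expand[OF M0L] rem[OF M0L] using M0 M0L N' by (auto simp: subset_iff split: if_splits)
    fix M
    assume M: "set_mset M \<subseteq> insert b L \<and> \<not> D \<subseteq># M \<and> \<Sum>\<^sub># (image_mset box M) = N"
    then obtain M1 j where M1: "set_mset M1 \<subseteq> L" "M = M1 + replicate_mset j b"
      using split by blast
    have "image_mset r (M1 + repeat_mset j D) = image_mset r N'"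
      using M M1 N' expand by metis
    then have "M1 + repeat_mset j D = M0 + repeat_mset k D"
      using image_mset_inj_on[OF r, of "M1 + repeat_mset j D" N'] M1 setD N' M0 by simp
    moreover have "\<not> D \<subseteq># M1" using M M1 rem by metis
    ultimately show "M = M0 + replicate_mset k b"
      using multiset_division_unique M0 M1 by metis
  qed
qed

text \<open>The counterpart for rows in which every letter stands for a single root, stated in the same form
  so that both kinds of rows can be treated alike.\<close>

lemma singleton_expansion_bijective:
  assumes r: "inj_on r L" and box: "\<And>x. x \<in> L \<Longrightarrow> box x = {#r x#}"
    and D: "\<not> set_mset D \<subseteq> L" and N: "set_mset N \<subseteq> r ` L"
  shows "\<exists>!M. set_mset M \<subseteq> L \<and> \<not> D \<subseteq># M \<and> \<Sum>\<^sub># (image_mset box M) = N"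
proof -
  have sum: "\<Sum>\<^sub># (image_mset box M) = image_mset r M" if "set_mset M \<subseteq> L" for M
  proof -
    have "image_mset box M = image_mset (\<lambda>x. {#r x#}) M"
      using that box by (intro image_mset_cong) auto
    then show ?thesis by (simp add: sum_image_mset_singletons)
  qed
  obtain M where M: "set_mset M \<subseteq> L" "image_mset r M = N"
    using ex_image_mset[OF N] by blast
  have "\<not> D \<subseteq># M'" if "set_mset M' \<subseteq> L" for M'
    using D that by (meson order_trans set_mset_mono)
  then show ?thesis
    using M sum image_mset_inj_on[OF r] by (intro ex1I[of _ M]) auto
qed


section \<open>Rows as multisets of letters\<close>

text \<open>The two letters that cannot occur together in a row. In types \<open>A\<close> and \<open>C\<close> there is no
  letter \<open>0\<close>, so that \<open>(0, 0)\<close> imposes no condition there.\<close>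

fun bar_pair :: "lie_type \<Rightarrow> letter \<times> letter" where
  "bar_pair (TypeD n) = (Pos n, Bar n)"
| "bar_pair _ = (Zero, Zero)"

definition bar_letters :: "lie_type \<Rightarrow> letter multiset" where
  "bar_letters g = {#fst (bar_pair g), snd (bar_pair g)#}"

lemma inj_letter_position: "inj_on (letter_position (dim g)) (letters g)"
  by (cases g) (auto simp: inj_on_def)

lemma letter_step_iff:
  assumes "x \<in> letters g" "y \<in> letters g"
  shows "letter_less g x y \<or> (x = y \<and> x \<noteq> Zero) \<longleftrightarrow>
    letter_position (dim g) x \<le> letter_position (dim g) y \<and> (x, y) \<noteq> bar_pair g \<and> (y, x) \<noteq> bar_pair g"
  using assms by (cases g; cases x; cases y) (auto simp: letter_less_def)

lemma pair_subseteq_add_mset: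
  "{#p, q#} \<subseteq># add_mset x M \<longleftrightarrow> {#p, q#} \<subseteq># M \<or> (x = p \<and> q \<in># M) \<or> (x = q \<and> p \<in># M)"
proof -
  have swap: "{#p, q#} = {#q, p#}" by (simp add: add_mset_commute)
  consider "x = p" | "x = q" | "x \<noteq> p" "x \<noteq> q" by blast
  then show ?thesis
  proof cases
    case 1
    then show ?thesis by (auto dest: mset_subset_eqD)
  next
    case 2
    then show ?thesis unfolding swap by (auto dest: mset_subset_eqD)
  next
    case 3
    then show ?thesis by (simp add: insert_subset_eq_iff)
  qed
qed

text \<open>This separates the admissibility of a row into a condition on the order of its letters and
  one on its multiset of letters.\<close>

lemma row_increasing_iff:
  assumes "set w \<subseteq> letters g"
  shows "row_increasing g w \<longleftrightarrow>
    sorted (map (letter_position (dim g)) w) \<and> \<not> bar_letters g \<subseteq># mset w"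
  using assms
proof (induction w)
  case Nil
  show ?case by (simp add: row_increasing_def bar_letters_def)
next
  case (Cons x w)
  have "bar_letters g \<subseteq># mset (x # w) \<longleftrightarrow> bar_letters g \<subseteq># mset w
      \<or> (\<exists>y\<in>set w. (x, y) = bar_pair g \<or> (y, x) = bar_pair g)"
    unfolding bar_letters_def by (cases "bar_pair g") (auto simp: pair_subseteq_add_mset)
  moreover have "row_increasing g (x # w) \<longleftrightarrow> row_increasing g w \<and> (\<forall>y\<in>set w.
      letter_position (dim g) x \<le> letter_position (dim g) y \<and> (x, y) \<noteq> bar_pair g \<and> (y, x) \<noteq> bar_pair g)"
    using Cons.prems letter_step_iff[of x g] by (auto simp: row_increasing_def)
  ultimately show ?case using Cons by auto
qed

lemma ex1_row_increasing:
  assumes "set_mset M \<subseteq> letters g" "\<not> bar_letters g \<subseteq># M"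
  shows "\<exists>!w. mset w = M \<and> row_increasing g w"
proof -
  let ?pos = "letter_position (dim g)"
  obtain xs where xs: "mset xs = M" using ex_mset by blast
  have set: "set w \<subseteq> letters g" if "mset w = M" for w
    using that assms(1) by (metis set_mset_mset)
  show ?thesis
  proof (rule ex1I[of _ "sort_key ?pos xs"])
    have "mset (sort_key ?pos xs) = M" using xs by simp
    then show "mset (sort_key ?pos xs) = M \<and> row_increasing g (sort_key ?pos xs)"
      using row_increasing_iff[OF set] assms(2) by simp
    fix w assume w: "mset w = M \<and> row_increasing g w"
    then have "sorted (map ?pos w)" using row_increasing_iff[OF set] by blast
    moreover have "inj_on ?pos (set xs)"
      using inj_letter_position set[OF xs] by (rule inj_on_subset)
    ultimately show "w = sort_key ?pos xs"
      using sort_key_inj_key_eq[of xs w ?pos] xs w by simp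
  qed
qed


section \<open>Boxes and positive roots\<close>

text \<open>The letters other than \<open>i\<close> itself that can occur in row \<open>i\<close> of a marginally large tableau.\<close>

definition row_letters :: "lie_type \<Rightarrow> nat \<Rightarrow> letter set" where
  "row_letters g i = {x \<in> letters g. i < letter_position (dim g) x \<and> row_bound g i x}"

text \<open>The letters of row \<open>i\<close> that contribute exactly one root. The letter \<open>i-bar\<close> is one of them only
  in type \<open>C\<close>, where twice \<open>\<epsilon>\<^sub>i\<close> is a root.\<close>

definition root_letters :: "lie_type \<Rightarrow> nat \<Rightarrow> letter set" where
  "root_letters g i = {x \<in> row_letters g i. x = Bar i \<longrightarrow> (\<exists>n. g = TypeC n)}"

definition box_root :: "lie_type \<Rightarrow> nat \<Rightarrow> letter \<Rightarrow> weight" where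
  "box_root g i x = letter_weight g (Pos i) - letter_weight g x"

lemma row_letters_classical:
  assumes "1 \<le> i"
  shows "row_letters (TypeA n) i = Pos ` {i+1..n}"
    and "i \<le> n \<Longrightarrow> row_letters (TypeB n) i = Pos ` {i+1..n} \<union> {Zero} \<union> Bar ` {i..n}"
    and "i \<le> n \<Longrightarrow> row_letters (TypeC n) i = Pos ` {i+1..n} \<union> Bar ` {i..n}"
    and "i < n \<Longrightarrow> row_letters (TypeD n) i = Pos ` {i+1..n} \<union> Bar ` {i..n}"
  using assms by (auto simp: row_letters_def letter_le_def letter_less_def)

lemma atLeastAtMost_1_3: "{1..3} = {1, 2, 3 :: nat}"
  by auto

lemma row_letters_G2:
  "row_letters TypeG2 1 = {Pos 2, Pos 3, Zero, Bar 3, Bar 2, Bar 1}"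
  "row_letters TypeG2 2 = {Pos 3}"
  by (auto simp: row_letters_def letter_le_def letter_less_def atLeastAtMost_1_3)

lemma root_letters_classical:
  assumes "1 \<le> i"
  shows "root_letters (TypeA n) i = Pos ` {i+1..n}"
    and "i \<le> n \<Longrightarrow> root_letters (TypeB n) i = Pos ` {i+1..n} \<union> {Zero} \<union> Bar ` {i+1..n}"
    and "i \<le> n \<Longrightarrow> root_letters (TypeC n) i = Pos ` {i+1..n} \<union> Bar ` {i..n}"
    and "i < n \<Longrightarrow> root_letters (TypeD n) i = Pos ` {i+1..n} \<union> Bar ` {i+1..n}"
  using assms by (auto simp: root_letters_def row_letters_classical)

lemma root_letters_G2:
  "root_letters TypeG2 1 = {Pos 2, Pos 3, Zero, Bar 3, Bar 2}"
  "root_letters TypeG2 2 = {Pos 3}"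
  by (auto simp: root_letters_def row_letters_G2 row_letters_G2(1)[simplified])

abbreviation coord :: "weight \<Rightarrow> nat \<Rightarrow> int" where
  "coord \<equiv> Poly_Mapping.lookup"

lemma coord_eps: "coord (\<epsilon> i) k = (if i = k then 1 else 0)"
  by (simp add: lookup_single when_def)

lemma coord_twice: "coord (2 * v) k = 2 * coord v k"
  unfolding mult_2 lookup_add by (rule refl)

lemmas coord_simps = coord_eps coord_twice lookup_add lookup_minus

lemma letter_weight_Pos_classical: "g \<noteq> TypeG2 \<Longrightarrow> letter_weight g (Pos i) = \<epsilon> i"
  by (cases g) auto

lemma letter_weight_inj_classical:
  assumes "g \<noteq> TypeG2" "letter_weight g x = letter_weight g y"
  shows "x = y"
proof -
  have pos: "z = Pos i \<longleftrightarrow> coord (letter_weight g z) i = 1" for z i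
    using letter_weight_Pos_classical[OF assms(1)] by (cases z) (auto simp: coord_simps)
  have bar: "z = Bar i \<longleftrightarrow> coord (letter_weight g z) i = -1" for z i
    using letter_weight_Pos_classical[OF assms(1)] by (cases z) (auto simp: coord_simps)
  have "x = Pos i \<longleftrightarrow> y = Pos i" "x = Bar i \<longleftrightarrow> y = Bar i" for i
    unfolding pos bar assms(2) by (rule refl)+
  then show ?thesis by (metis letter.exhaust)
qed

text \<open>In the classical types the row of a box is the index of the first nonzero coordinate of its
  root: the letters of row \<open>i\<close> involve only the coordinates from \<open>i\<close> on, and the coefficient of
  \<open>\<epsilon>\<^sub>i\<close> is \<open>1\<close> or \<open>2\<close>.\<close>

lemma coord_box_root:
  assumes "g \<noteq> TypeG2" "1 \<le> i" "i \<le> num_rows g" "x \<in> root_letters g i"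
  shows "coord (box_root g i x) i \<noteq> 0" "k < i \<Longrightarrow> coord (box_root g i x) k = 0"
proof -
  have "x = Zero \<or> (\<exists>j. i < j \<and> x \<in> {Pos j, Bar j}) \<or> x = Bar i"
    using assms by (cases g) (auto simp: root_letters_classical)
  then show "coord (box_root g i x) i \<noteq> 0" "k < i \<Longrightarrow> coord (box_root g i x) k = 0"
    using letter_weight_Pos_classical[OF assms(1)]
    by (auto simp: box_root_def coord_simps)
qed

lemma boxes_G2:
  "(SIGMA i:{1..num_rows TypeG2}. root_letters TypeG2 i) =
     {(1, Pos 2), (1, Pos 3), (1, Zero), (1, Bar 3), (1, Bar 2), (2, Pos 3)}"
proof -
  have "{1..num_rows TypeG2} = {1, 2}" by auto
  moreover have "Sigma {1, 2} (root_letters TypeG2) =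
      Pair 1 ` root_letters TypeG2 1 \<union> Pair 2 ` root_letters TypeG2 2"
    by auto
  ultimately show ?thesis by (simp only: root_letters_G2 image_insert image_empty) auto
qed

lemma inj_box_root:
  "inj_on (\<lambda>(i, x). box_root g i x) (SIGMA i:{1..num_rows g}. root_letters g i)"
proof (cases "g = TypeG2")
  case False
  show ?thesis
  proof (rule inj_onI, clarify)
    fix i x j y
    assume i: "i \<in> {1..num_rows g}" "x \<in> root_letters g i"
      and j: "j \<in> {1..num_rows g}" "y \<in> root_letters g j"
      and eq: "box_root g i x = box_root g j y"
    have "i = j"
      using coord_box_root[OF False _ _ i(2)] coord_box_root[OF False _ _ j(2)] i(1) j(1) eq
      by (metis atLeastAtMost_iff linorder_neqE_nat)
    with eq letter_weight_inj_classical[OF False, of x y] show "i = j \<and> x = y"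
      by (simp add: box_root_def)
  qed
next
  case True
  note boxes = boxes_G2[folded True]
  \<comment> \<open>The functional \<open>4 v\<^sub>1 + v\<^sub>2\<close> takes the six distinct values \<open>3, -4, -1, 2, -5, -7\<close> on the
    positive roots.\<close>
  have "inj_on ((\<lambda>v. 4 * coord v 1 + coord v 2) \<circ> (\<lambda>(i, x). box_root g i x))
      (SIGMA i:{1..num_rows g}. root_letters g i)"
    unfolding boxes using True by (simp add: box_root_def coord_simps)
  then show ?thesis by (rule inj_on_imageI2)
qed

text \<open>The number \<open>m\<close> of rows is \<open>n - 1\<close> or \<open>n\<close>. This makes no difference, since there is no pair
  with \<open>i = n\<close>.\<close>

lemma pairs_eq_UN:
  assumes "n \<le> Suc m"
  shows "{f i j | i j. 1 \<le> i \<and> i < j \<and> j \<le> n} = (\<Union>i\<in>{1..m}. f i ` {i+1..n})"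
proof -
  have "f i j \<in> (\<Union>i\<in>{1..m}. f i ` {i+1..n})" if "1 \<le> i" "i < j" "j \<le> n" for i j
  proof (rule UN_I)
    show "i \<in> {1..m}" "f i j \<in> f i ` {i+1..n}" using that assms by auto
  qed
  moreover have "\<exists>k l. f i j = f k l \<and> 1 \<le> k \<and> k < l \<and> l \<le> n" if "i \<in> {1..m}" "j \<in> {i+1..n}" for i j
    using that by (intro exI[of _ i] exI[of _ j]) auto
  ultimately show ?thesis by blast
qed

lemma singles_eq_UN: "{f i | i. 1 \<le> i \<and> i \<le> n} = (\<Union>i\<in>{1..n :: nat}. {f i})"
  by auto

lemma pos_roots_eq_box_roots:
  assumes "valid_type g"
  shows "pos_roots g = (\<lambda>(i, x). box_root g i x) ` (SIGMA i:{1..num_rows g}. root_letters g i)"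
proof -
  have union: "(\<lambda>(i, x). box_root g i x) ` (SIGMA i:{1..num_rows g}. root_letters g i)
      = (\<Union>i\<in>{1..num_rows g}. box_root g i ` root_letters g i)"
    by auto
  show ?thesis
  proof (cases g)
    case (TypeA n)
    have "box_root g i ` root_letters g i = (\<lambda>j. \<epsilon> i - \<epsilon> j) ` {i+1..n}" if "i \<in> {1..num_rows g}" for i
      using that TypeA by (simp add: root_letters_classical box_root_def image_image)
    then have "(\<Union>i\<in>{1..num_rows g}. box_root g i ` root_letters g i) =
        (\<Union>i\<in>{1..num_rows g}. (\<lambda>j. \<epsilon> i - \<epsilon> j) ` {i+1..n})"
      by (rule SUP_cong[OF refl])
    also have "\<dots> = pos_roots g"
      unfolding TypeA pos_roots.simps num_rows.simps by (subst pairs_eq_UN[of n "n - 1"]) auto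
    finally show ?thesis unfolding union ..
  next
    case (TypeB n)
    have "box_root g i ` root_letters g i =
        (\<lambda>j. \<epsilon> i - \<epsilon> j) ` {i+1..n} \<union> (\<lambda>j. \<epsilon> i + \<epsilon> j) ` {i+1..n} \<union> {\<epsilon> i}"
      if "i \<in> {1..num_rows g}" for i
      using that TypeB by (simp add: root_letters_classical box_root_def image_image image_Un ac_simps)
    then have "(\<Union>i\<in>{1..num_rows g}. box_root g i ` root_letters g i) = (\<Union>i\<in>{1..num_rows g}.
        (\<lambda>j. \<epsilon> i - \<epsilon> j) ` {i+1..n} \<union> (\<lambda>j. \<epsilon> i + \<epsilon> j) ` {i+1..n} \<union> {\<epsilon> i})"
      by (rule SUP_cong[OF refl])
    also have "\<dots> = pos_roots g"
      unfolding TypeB pos_roots.simps num_rows.simps UN_Un_distrib singles_eq_UN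
      by (subst (1 2) pairs_eq_UN[of n n]) auto
    finally show ?thesis unfolding union ..
  next
    case (TypeC n)
    have "box_root g i ` root_letters g i =
        (\<lambda>j. \<epsilon> i - \<epsilon> j) ` {i+1..n} \<union> (\<lambda>j. \<epsilon> i + \<epsilon> j) ` {i+1..n} \<union> {\<epsilon> i + \<epsilon> i}"
      if "i \<in> {1..num_rows g}" for i
    proof -
      have "{i..n} = insert i {i+1..n}" using that TypeC by auto
      then show ?thesis
        using that TypeC
        by (simp add: root_letters_classical box_root_def image_image image_Un del: mult_2 mult_2_right)
    qed
    then have "(\<Union>i\<in>{1..num_rows g}. box_root g i ` root_letters g i) = (\<Union>i\<in>{1..num_rows g}.
        (\<lambda>j. \<epsilon> i - \<epsilon> j) ` {i+1..n} \<union> (\<lambda>j. \<epsilon> i + \<epsilon> j) ` {i+1..n} \<union> {\<epsilon> i + \<epsilon> i})"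
      by (rule SUP_cong[OF refl])
    also have "\<dots> = pos_roots g"
      unfolding TypeC pos_roots.simps num_rows.simps UN_Un_distrib singles_eq_UN
      by (subst (1 2) pairs_eq_UN[of n n]) auto
    finally show ?thesis unfolding union ..
  next
    case (TypeD n)
    have "box_root g i ` root_letters g i =
        (\<lambda>j. \<epsilon> i - \<epsilon> j) ` {i+1..n} \<union> (\<lambda>j. \<epsilon> i + \<epsilon> j) ` {i+1..n}" if "i \<in> {1..num_rows g}" for i
    proof -
      have "1 \<le> i" "i < n" using that TypeD by auto
      then show ?thesis
        using TypeD by (simp add: root_letters_classical box_root_def image_image image_Un)
    qed
    then have "(\<Union>i\<in>{1..num_rows g}. box_root g i ` root_letters g i) = (\<Union>i\<in>{1..num_rows g}.
        (\<lambda>j. \<epsilon> i - \<epsilon> j) ` {i+1..n} \<union> (\<lambda>j. \<epsilon> i + \<epsilon> j) ` {i+1..n})"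
      by (rule SUP_cong[OF refl])
    also have "\<dots> = pos_roots g"
      unfolding TypeD pos_roots.simps num_rows.simps UN_Un_distrib
      by (subst (1 2) pairs_eq_UN[of n "n - 1"]) auto
    finally show ?thesis unfolding union ..
  next
    case TypeG2
    show ?thesis
      unfolding TypeG2 boxes_G2 by (simp add: box_root_def algebra_simps insert_commute)
  qed
qed


section \<open>Rows as multisets of roots\<close>

lemma letter_position_ge_1: "x \<in> letters g \<Longrightarrow> 1 \<le> letter_position (dim g) x"
  by (cases g; cases x) auto

lemma Pos_in_letters: "valid_type g \<Longrightarrow> i \<in> {1..num_rows g} \<Longrightarrow> Pos i \<in> letters g"
  by (cases g) auto

lemma Pos_notin_row_letters: "Pos i \<notin> row_letters g i"
  by (simp add: row_letters_def)

lemma letter_less_Pos: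
  assumes "valid_type g" "i \<in> {1..num_rows g}" "i < letter_position (dim g) x"
  shows "letter_less g (Pos i) x"
  using assms by (cases g) (auto simp: letter_less_def)

lemma row_bound_Pos:
  assumes "valid_type g" "i \<in> {1..num_rows g}"
  shows "row_bound g i (Pos i)"
  using assms by (cases g) (auto simp: letter_le_def letter_less_def)

lemma box_roots_root_letter:
  assumes "x \<in> root_letters g i"
  shows "box_roots g i x = {#box_root g i x#}"
proof (cases "x = Bar i")
  case True
  then obtain n where "g = TypeC n" using assms by (auto simp: root_letters_def)
  with True show ?thesis by (simp add: box_roots_def box_root_def)
next
  case False
  moreover have "x \<noteq> Pos i" using assms Pos_notin_row_letters by (auto simp: root_letters_def)
  ultimately show ?thesis by (simp add: box_roots_def box_root_def)
qed

text \<open>The dichotomy between rows in which every letter stands for one root (types \<open>A\<close> and \<open>C\<close>,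
  second row of type \<open>G\<^sub>2\<close>) and rows in which \<open>i-bar\<close> is shorthand for the two letters of
  \<open>bar_letters\<close>.\<close>

lemma row_letters_cases:
  assumes "valid_type g" "i \<in> {1..num_rows g}"
  obtains (singletons) "row_letters g i = root_letters g i" "\<not> set_mset (bar_letters g) \<subseteq> root_letters g i"
  | (bar) "row_letters g i = insert (Bar i) (root_letters g i)" "Bar i \<notin> root_letters g i"
      "set_mset (bar_letters g) \<subseteq> root_letters g i"
      "box_roots g i (Bar i) = image_mset (box_root g i) (bar_letters g)"
proof (cases g)
  case (TypeA n)
  then show thesis using assms
    by (intro singletons) (auto simp: row_letters_classical root_letters_classical bar_letters_def)
next
  case (TypeB n)
  then show thesis using assms
    by (intro bar) (auto simp: row_letters_classical root_letters_classical bar_letters_def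
        box_roots_def box_root_def)
next
  case (TypeC n)
  then show thesis using assms
    by (intro singletons) (auto simp: row_letters_classical root_letters_classical bar_letters_def)
next
  case (TypeD n)
  then have "1 \<le> i" "i < n" using assms by auto
  with TypeD show thesis
    by (intro bar) (auto simp: row_letters_classical root_letters_classical bar_letters_def
        box_roots_def box_root_def)
next
  case TypeG2
  then consider "i = 1" | "i = 2" using assms by fastforce
  then show thesis
  proof cases
    case 1
    with TypeG2 show thesis
      by (intro bar) (auto simp: row_letters_G2[simplified] root_letters_G2[simplified]
          bar_letters_def box_roots_def box_root_def)
  next
    case 2
    with TypeG2 show thesis
      by (intro singletons) (auto simp: row_letters_G2 root_letters_G2 bar_letters_def)
  qed
qed

definition row_roots :: "lie_type \<Rightarrow> nat \<Rightarrow> letter list \<Rightarrow> weight multiset" where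
  "row_roots g i w = (\<Sum>x\<leftarrow>w. box_roots g i x)"

lemma row_roots_conv_mset: "row_roots g i w = \<Sum>\<^sub># (image_mset (box_roots g i) (mset w))"
  by (simp add: row_roots_def flip: sum_mset_sum_list)

lemma set_row_roots:
  assumes "valid_type g" "i \<in> {1..num_rows g}" "set w \<subseteq> row_letters g i"
  shows "set_mset (row_roots g i w) \<subseteq> box_root g i ` root_letters g i"
proof -
  have "set_mset (box_roots g i x) \<subseteq> box_root g i ` root_letters g i" if "x \<in> row_letters g i" for x
  proof (cases "x \<in> root_letters g i")
    case True
    then show ?thesis by (simp add: box_roots_root_letter)
  next
    case False
    show ?thesis
      using assms(1,2)
    proof (cases rule: row_letters_cases)
      case singletons
      with that False show ?thesis by simp
    next
      case bar
      with that False have "x = Bar i" by simp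
      then show ?thesis using bar(3,4) by auto
    qed
  qed
  then show ?thesis using assms(3) unfolding row_roots_conv_mset by fastforce
qed

text \<open>A row, apart from its letters \<open>i\<close>, is determined by its roots, and every multiset of roots
  of the row arises: the roots determine the multiset of letters, and this has exactly one
  increasing arrangement.\<close>

lemma ex1_row_word:
  assumes "valid_type g" "i \<in> {1..num_rows g}"
    and N: "set_mset N \<subseteq> box_root g i ` root_letters g i"
  shows "\<exists>!w. set w \<subseteq> row_letters g i \<and> row_increasing g w \<and> row_roots g i w = N"
proof -
  have inj: "inj_on (box_root g i) (root_letters g i)"
    using inj_box_root[of g] assms(2) by (auto simp: inj_on_def)
  have "\<exists>!M. set_mset M \<subseteq> row_letters g i \<and> \<not> bar_letters g \<subseteq># M
      \<and> \<Sum>\<^sub># (image_mset (box_roots g i) M) = N"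
    using assms(1,2)
  proof (cases rule: row_letters_cases)
    case singletons
    show ?thesis unfolding singletons(1)
      by (rule singleton_expansion_bijective[OF inj box_roots_root_letter singletons(2) N])
  next
    case bar
    have nonempty: "bar_letters g \<noteq> {#}" by (simp add: bar_letters_def)
    show ?thesis unfolding bar(1)
      using inj box_roots_root_letter bar(2) nonempty bar(3,4) N by (rule expansion_bijective)
  qed
  then obtain M where M: "set_mset M \<subseteq> row_letters g i \<and> \<not> bar_letters g \<subseteq># M
        \<and> \<Sum>\<^sub># (image_mset (box_roots g i) M) = N"
    and M_unique: "\<forall>M'. set_mset M' \<subseteq> row_letters g i \<and> \<not> bar_letters g \<subseteq># M'
        \<and> \<Sum>\<^sub># (image_mset (box_roots g i) M') = N \<longrightarrow> M' = M"
    by (rule ex1E)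
  have letters: "row_letters g i \<subseteq> letters g" by (auto simp: row_letters_def)
  with M have "\<exists>!w. mset w = M \<and> row_increasing g w"
    by (intro ex1_row_increasing) auto
  then obtain w where w: "mset w = M \<and> row_increasing g w"
    and w_unique: "\<forall>v. mset v = M \<and> row_increasing g v \<longrightarrow> v = w"
    by (rule ex1E)
  show ?thesis
  proof (rule ex1I[of _ w])
    show "set w \<subseteq> row_letters g i \<and> row_increasing g w \<and> row_roots g i w = N"
      using M w by (auto simp: row_roots_conv_mset)
    fix v
    assume v: "set v \<subseteq> row_letters g i \<and> row_increasing g v \<and> row_roots g i v = N"
    then have "\<not> bar_letters g \<subseteq># mset v"
      using row_increasing_iff[of v g] letters by blast
    with v have "mset v = M"
      by (intro M_unique[rule_format]) (simp add: row_roots_conv_mset)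
    with v w_unique show "v = w" by blast
  qed
qed


section \<open>Tableaux as multisegments\<close>

text \<open>The free part of a row: the number of letters \<open>i\<close> in row \<open>i\<close> is forced by the rows below.\<close>

definition row_word :: "tableau \<Rightarrow> nat \<Rightarrow> letter list" where
  "row_word T i = filter (\<lambda>x. x \<noteq> Pos i) (row T i)"

lemma Xi_conv_row_word: "\<Xi> g T = (\<Sum>i=1..num_rows g. row_roots g i (row_word T i))"
proof -
  have "(\<Sum>x\<leftarrow>w. box_roots g i x) = row_roots g i (filter (\<lambda>x. x \<noteq> Pos i) w)" for i w
    by (induction w) (auto simp: row_roots_def box_roots_def)
  then show ?thesis by (simp add: \<Xi>_def row_word_def)
qed

lemma sorted_wrt_filter_first:
  assumes "sorted_wrt R xs" "\<And>x. x \<in> set xs \<Longrightarrow> R x a \<Longrightarrow> x = a"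
  shows "xs = replicate (count_list xs a) a @ filter (\<lambda>x. x \<noteq> a) xs"
  using assms
proof (induction xs)
  case (Cons x xs)
  show ?case
  proof (cases "x = a")
    case True
    then show ?thesis using Cons by simp
  next
    case False
    then have "a \<notin> set xs" using Cons.prems by auto
    then have "count_list xs a = 0" "filter (\<lambda>x. x \<noteq> a) xs = xs"
      by (auto simp: filter_id_conv)
    with False show ?thesis by simp
  qed
qed simp

text \<open>The columns increase strictly, so that a letter in row \<open>i\<close> has at least \<open>i - 1\<close> letters below
  it in the order.\<close>

lemma T_inf_letter_position:
  assumes "T \<in> T_inf g" "i \<in> {1..num_rows g}" "x \<in> set (row T i)"
  shows "i \<le> letter_position (dim g) x"
  using assms(2,3)
proof (induction i arbitrary: x)
  case (Suc i)
  have T: "g_tableau g T" using assms(1) by (simp add: T_inf_def)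
  show ?case
  proof (cases "i = 0")
    case True
    have "x \<in> letters g" using T Suc.prems unfolding g_tableau_def by blast
    with True letter_position_ge_1 show ?thesis by simp
  next
    case False
    then have i: "i \<in> {1..<num_rows g}" using Suc.prems by simp
    obtain c where c: "c < length (row T (i + 1))" "x = row T (i + 1) ! c"
      using Suc.prems by (metis Suc_eq_plus1 in_set_conv_nth)
    have less: "letter_less g (row T i ! c) x" and len: "length (row T (i + 1)) \<le> length (row T i)"
      using T i c unfolding g_tableau_def by auto
    have "i \<le> letter_position (dim g) (row T i ! c)"
      using i c(1) len by (intro Suc.IH) auto
    then show ?thesis using less by (simp add: letter_less_def)
  qed
qed simp

text \<open>As \<open>i\<close> is the least letter that row \<open>i\<close> can contain, the copies of \<open>i\<close> come first.\<close>

lemma T_inf_row: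
  assumes "T \<in> T_inf g" "i \<in> {1..num_rows g}"
  shows "row T i = replicate (1 + length (row T (i + 1))) (Pos i) @ row_word T i"
    and "set (row_word T i) \<subseteq> row_letters g i" "row_increasing g (row_word T i)"
proof -
  have T: "set (row T i) \<subseteq> letters g" "row_increasing g (row T i)" "\<forall>x\<in>set (row T i). row_bound g i x"
    and count: "count_list (row T i) (Pos i) = 1 + length (row T (i + 1))"
    using assms by (auto simp: T_inf_def g_tableau_def)
  note pos = T_inf_letter_position[OF assms]
  have "row T i = replicate (count_list (row T i) (Pos i)) (Pos i) @ filter (\<lambda>x. x \<noteq> Pos i) (row T i)"
    using T(2) unfolding row_increasing_def
    by (rule sorted_wrt_filter_first) (use pos in \<open>fastforce simp: letter_less_def\<close>)
  then show "row T i = replicate (1 + length (row T (i + 1))) (Pos i) @ row_word T i"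
    unfolding count row_word_def .
  show "row_increasing g (row_word T i)"
    using T(2) unfolding row_increasing_def row_word_def by (rule sorted_wrt_filter)
  show "set (row_word T i) \<subseteq> row_letters g i"
  proof
    fix x assume "x \<in> set (row_word T i)"
    then have x: "x \<in> set (row T i)" "x \<noteq> Pos i" by (auto simp: row_word_def)
    have "i \<noteq> letter_position (dim g) x"
    proof
      assume eq: "i = letter_position (dim g) x"
      have "i \<le> dim g" using assms(2) by (cases g) auto
      moreover have "x \<in> letters g" using T(1) x(1) by blast
      ultimately have "x = Pos i" using eq by (cases g; cases x) auto
      with x(2) show False by simp
    qed
    with pos[OF x(1)] T(1,3) x(1) show "x \<in> row_letters g i" by (auto simp: row_letters_def)
  qed
qed

text \<open>The length that is forced on row \<open>i\<close> by the words in the rows \<open>i, i + 1, \<dots>\<close>: each of these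
  rows has one letter, besides its word, more than the length of the next row.\<close>

definition row_length :: "lie_type \<Rightarrow> (nat \<Rightarrow> letter list) \<Rightarrow> nat \<Rightarrow> nat" where
  "row_length g w i = (\<Sum>j=i..num_rows g. 1 + length (w j))"

definition tableau_of_words :: "lie_type \<Rightarrow> (nat \<Rightarrow> letter list) \<Rightarrow> tableau" where
  "tableau_of_words g w =
     map (\<lambda>i. replicate (1 + row_length g w (i + 1)) (Pos i) @ w i) [1..<num_rows g + 1]"

lemma row_tableau_of_words:
  "row (tableau_of_words g w) i =
     (if i \<in> {1..num_rows g} then replicate (1 + row_length g w (i + 1)) (Pos i) @ w i else [])"
  by (auto simp: row_def tableau_of_words_def simp del: upt_Suc)

lemma row_length_rec:
  "i \<in> {1..num_rows g} \<Longrightarrow> row_length g w i = 1 + length (w i) + row_length g w (i + 1)"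
  by (simp add: row_length_def sum.atLeast_Suc_atMost)

lemma length_row_tableau_of_words:
  "1 \<le> i \<Longrightarrow> length (row (tableau_of_words g w) i) = row_length g w i"
  using row_length_rec[of i g w] by (auto simp: row_tableau_of_words row_length_def)

text \<open>The rows can be prescribed independently of each other. The leading letters \<open>i\<close> of row \<open>i\<close>
  extend beyond the end of row \<open>i + 1\<close>, so that a column has \<open>i\<close> right above any entry of row
  \<open>i + 1\<close>, and it increases for that reason.\<close>

lemma tableau_of_words_in_T_inf:
  assumes g: "valid_type g"
    and w: "\<And>i. i \<in> {1..num_rows g} \<Longrightarrow> set (w i) \<subseteq> row_letters g i \<and> row_increasing g (w i)"
  shows "tableau_of_words g w \<in> T_inf g"
proof -
  let ?T = "tableau_of_words g w"
  have set_row: "set (row ?T i) \<subseteq> insert (Pos i) (row_letters g i)" if "i \<in> {1..num_rows g}" for i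
    using w[OF that] that by (auto simp: row_tableau_of_words)
  have row: "set (row ?T i) \<subseteq> letters g \<and> row_increasing g (row ?T i) \<and> (\<forall>x\<in>set (row ?T i). row_bound g i x)"
    if i: "i \<in> {1..num_rows g}" for i
  proof (intro conjI)
    show "set (row ?T i) \<subseteq> letters g" "\<forall>x\<in>set (row ?T i). row_bound g i x"
      using set_row[OF i] Pos_in_letters[OF g i] row_bound_Pos[OF g i] by (auto simp: row_letters_def)
    have "sorted_wrt (\<lambda>x y. letter_less g x y \<or> (x = y \<and> x \<noteq> Zero)) (replicate k (Pos i))" for k
      by (induction k) auto
    then show "row_increasing g (row ?T i)"
      using i w[OF i] letter_less_Pos[OF g i]
      by (auto simp: row_tableau_of_words row_increasing_def sorted_wrt_append row_letters_def
          simp del: replicate_Suc replicate.simps)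
  qed
  have column: "length (row ?T (i + 1)) \<le> length (row ?T i)
      \<and> (\<forall>c<length (row ?T (i + 1)). letter_less g (row ?T i ! c) (row ?T (i + 1) ! c))"
    if i: "i \<in> {1..<num_rows g}" for i
  proof (intro conjI allI impI)
    have i': "i \<in> {1..num_rows g}" "i + 1 \<in> {1..num_rows g}" using i by auto
    show "length (row ?T (i + 1)) \<le> length (row ?T i)"
      using i' row_length_rec[OF i'(1)] by (simp add: length_row_tableau_of_words)
    fix c assume c: "c < length (row ?T (i + 1))"
    then have "row ?T i ! c = Pos i"
      using i' length_row_tableau_of_words[of "i + 1" g w]
      by (simp add: row_tableau_of_words[of _ _ i] nth_append del: replicate_Suc replicate.simps)
    moreover have "row ?T (i + 1) ! c \<in> insert (Pos (i + 1)) (row_letters g (i + 1))"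
      using set_row[OF i'(2)] nth_mem[OF c] by blast
    then have "i < letter_position (dim g) (row ?T (i + 1) ! c)"
      by (auto simp: row_letters_def)
    ultimately show "letter_less g (row ?T i ! c) (row ?T (i + 1) ! c)"
      using letter_less_Pos[OF g i'(1)] by simp
  qed
  have count: "count_list (row ?T i) (Pos i) = 1 + length (row ?T (i + 1))"
    if i: "i \<in> {1..num_rows g}" for i
  proof -
    have "count_list (replicate k (Pos i)) (Pos i) = k" for k by (induction k) auto
    moreover have "count_list (w i) (Pos i) = 0"
      using w[OF i] Pos_notin_row_letters by (auto simp: count_list_0_iff)
    ultimately show ?thesis
      using i length_row_tableau_of_words[of "i + 1" g w]
      by (simp add: row_tableau_of_words[of _ _ i] count_list_append del: replicate_Suc replicate.simps)
  qed
  have "length ?T = num_rows g" by (simp add: tableau_of_words_def)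
  with row column count show ?thesis by (simp add: T_inf_def g_tableau_def)
qed

lemma row_word_tableau_of_words:
  assumes "i \<in> {1..num_rows g}" "set (w i) \<subseteq> row_letters g i"
  shows "row_word (tableau_of_words g w) i = w i"
proof -
  have "filter (\<lambda>x. x \<noteq> Pos i) (w i) = w i"
    using assms(2) Pos_notin_row_letters by (auto simp: filter_id_conv)
  with assms(1) show ?thesis by (simp add: row_word_def row_tableau_of_words)
qed

text \<open>Starting at the last row, the words determine the lengths of the rows and with them the
  number of leading letters.\<close>

lemma T_inf_eqI:
  assumes "T \<in> T_inf g" "T' \<in> T_inf g"
    and words: "\<And>i. i \<in> {1..num_rows g} \<Longrightarrow> row_word T i = row_word T' i"
  shows "T = T'"
proof -
  have len: "length T = num_rows g" "length T' = num_rows g"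
    using assms by (auto simp: T_inf_def g_tableau_def)
  have "row T i = row T' i" if "i \<le> num_rows g + 1" "1 \<le> i" for i
    using that
  proof (induction rule: inc_induct)
    case base
    show ?case using len by (simp add: row_def)
  next
    case (step i)
    then have i: "i \<in> {1..num_rows g}" by simp
    show ?case
      using T_inf_row(1)[OF assms(1) i] T_inf_row(1)[OF assms(2) i] words[OF i] step by simp
  qed
  then have "T ! j = T' ! j" if "j < num_rows g" for j
    using that len by (force simp: row_def dest!: spec[of _ "Suc j"])
  then show ?thesis using len by (intro nth_equalityI) auto
qed

text \<open>The positive roots are partitioned according to the rows, so that a multisegment splits
  into its row parts, each of which is the multiset of roots of exactly one word.\<close>

lemma bij_betw_Xi:
  assumes g: "valid_type g"
  shows "bij_betw (\<Xi> g) (T_inf g) {m. set_mset m \<subseteq> pos_roots g}"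
proof -
  let ?R = "\<lambda>i. box_root g i ` root_letters g i"
  let ?I = "{1..num_rows g}"
  have roots: "pos_roots g = (\<Union>i\<in>?I. ?R i)"
    unfolding pos_roots_eq_box_roots[OF g] by auto
  have disj: "?R i \<inter> ?R j = {}" if "i \<in> ?I" "j \<in> ?I" "i \<noteq> j" for i j
    using inj_box_root[of g] that by (fastforce simp: inj_on_def)
  \<comment> \<open>The part of row \<open>i\<close> can be cut out of the whole multisegment by its set of roots.\<close>
  have filter: "filter_mset (\<lambda>\<alpha>. \<alpha> \<in> ?R i) (\<Sum>j\<in>?I. N j) = N i"
    if i: "i \<in> ?I" and N: "\<And>j. j \<in> ?I \<Longrightarrow> set_mset (N j) \<subseteq> ?R j" for N :: "nat \<Rightarrow> weight multiset" and i
  proof -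
    have "filter_mset (\<lambda>\<alpha>. \<alpha> \<in> ?R i) (\<Sum>j\<in>?I. N j) = (\<Sum>j\<in>?I. filter_mset (\<lambda>\<alpha>. \<alpha> \<in> ?R i) (N j))"
      by (induction rule: finite_induct[OF finite_atLeastAtMost[of 1 "num_rows g"]]) auto
    also have "\<dots> = (\<Sum>j\<in>?I. if j = i then N i else {#})"
    proof (intro sum.cong refl)
      fix j assume j: "j \<in> ?I"
      show "filter_mset (\<lambda>\<alpha>. \<alpha> \<in> ?R i) (N j) = (if j = i then N i else {#})"
      proof (rule multiset_eqI)
        fix \<alpha>
        show "count (filter_mset (\<lambda>\<alpha>. \<alpha> \<in> ?R i) (N j)) \<alpha> = count (if j = i then N i else {#}) \<alpha>"
        proof (cases "\<alpha> \<in># N j")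
          case True
          then have "\<alpha> \<in> ?R i \<longleftrightarrow> j = i" using N[OF j] disj[OF i j] by blast
          then show ?thesis by simp
        qed (auto simp: not_in_iff)
      qed
    qed
    finally show ?thesis using i by simp
  qed
  have row_set: "set_mset (row_roots g i (row_word T i)) \<subseteq> ?R i" if "T \<in> T_inf g" "i \<in> ?I" for T i
    using set_row_roots[OF g that(2) T_inf_row(2)[OF that]] .
  have inj: "inj_on (\<Xi> g) (T_inf g)"
  proof (rule inj_onI)
    fix T T' assume T: "T \<in> T_inf g" "T' \<in> T_inf g" and eq: "\<Xi> g T = \<Xi> g T'"
    show "T = T'"
    proof (rule T_inf_eqI[OF T])
      fix i assume i: "i \<in> ?I"
      have "row_roots g i (row_word T i) = row_roots g i (row_word T' i)"
        using filter[OF i, of "\<lambda>i. row_roots g i (row_word T i)"]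
          filter[OF i, of "\<lambda>i. row_roots g i (row_word T' i)"] row_set T eq
        by (simp only: Xi_conv_row_word)
      then show "row_word T i = row_word T' i"
        using ex1_row_word[OF g i row_set[OF T(2) i]] T_inf_row(2,3)[OF T(1) i] T_inf_row(2,3)[OF T(2) i]
        by (metis (no_types, lifting))
    qed
  qed
  have "\<Xi> g T \<in> {m. set_mset m \<subseteq> pos_roots g}" if "T \<in> T_inf g" for T
    using row_set[OF that] unfolding roots by (fastforce simp: Xi_conv_row_word set_mset_sum)
  moreover have "m \<in> \<Xi> g ` T_inf g" if m: "set_mset m \<subseteq> pos_roots g" for m
  proof -
    let ?N = "\<lambda>i. filter_mset (\<lambda>\<alpha>. \<alpha> \<in> ?R i) m"
    have "\<exists>w. set w \<subseteq> row_letters g i \<and> row_increasing g w \<and> row_roots g i w = ?N i" if "i \<in> ?I" for i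
      using ex1_row_word[OF g that, of "?N i"] by auto
    then obtain w where w: "\<And>i. i \<in> ?I \<Longrightarrow>
        set (w i) \<subseteq> row_letters g i \<and> row_increasing g (w i) \<and> row_roots g i (w i) = ?N i"
      by metis
    let ?T = "tableau_of_words g w"
    have "?T \<in> T_inf g" using w by (intro tableau_of_words_in_T_inf g) blast
    moreover have "\<Xi> g ?T = m"
    proof -
      have "\<Xi> g ?T = (\<Sum>i\<in>?I. ?N i)"
        using w by (simp add: Xi_conv_row_word row_word_tableau_of_words)
      also have "\<dots> = m"
      proof (rule multiset_eqI)
        fix \<alpha>
        have "count (\<Sum>i\<in>?I. ?N i) \<alpha> = (\<Sum>i\<in>?I. if \<alpha> \<in> ?R i then count m \<alpha> else 0)"
          by (simp add: count_sum)
        also have "\<dots> = count m \<alpha>"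
        proof (cases "\<alpha> \<in># m")
          case True
          then obtain i where i: "i \<in> ?I" "\<alpha> \<in> ?R i" using m roots by blast
          have "(\<Sum>j\<in>?I. if \<alpha> \<in> ?R j then count m \<alpha> else 0) = (\<Sum>j\<in>?I. if j = i then count m \<alpha> else 0)"
            using disj i by (intro sum.cong refl) auto
          with i show ?thesis by simp
        qed (simp add: not_in_iff)
        finally show "count (\<Sum>i\<in>?I. ?N i) \<alpha> = count m \<alpha>" .
      qed
      finally show ?thesis .
    qed
    ultimately show ?thesis by blast
  qed
  ultimately show ?thesis unfolding bij_betw_def using inj by auto
qed

text \<open>The compatibility of \<open>\<Xi>\<close> with weights, box by box. Where \<open>i-bar\<close> contributes two roots, they
  add up to twice the weight of \<open>i\<close>.\<close>

lemma sum_box_roots: "\<Sum>\<^sub># (box_roots g i x) = letter_weight g (Pos i) - letter_weight g x"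
  by (cases g) (auto simp: box_roots_def)

lemma wt_eq: "wt g T = - \<Sum>\<^sub># (\<Xi> g T)"
proof -
  have "\<Sum>\<^sub># (\<Sum>x\<leftarrow>w. box_roots g i x) = - (\<Sum>x\<leftarrow>w. letter_weight g x - letter_weight g (Pos i))" for i w
    by (induction w) (auto simp: sum_box_roots simp del: letter_weight.simps)
  moreover have "\<Sum>\<^sub># (\<Sum>i\<in>A. N i) = (\<Sum>i\<in>A. \<Sum>\<^sub># (N i))" if "finite A" for A and N :: "nat \<Rightarrow> weight multiset"
    using that by (induction A rule: finite_induct) auto
  ultimately show ?thesis by (simp add: wt_def \<Xi>_def sum_negf)
qed


section \<open>The root cone\<close>

text \<open>Up to positive factors these are the fundamental coweights, which are dual to the simple
  roots. They serve to read off the coefficients of a combination of simple roots.\<close>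

fun coweight :: "lie_type \<Rightarrow> nat \<Rightarrow> weight \<Rightarrow> int" where
  "coweight (TypeD n) i v =
     (if i = n - 1 then (\<Sum>k=1..n-1. coord v k) - coord v n else (\<Sum>k=1..i. coord v k))"
| "coweight TypeG2 i v = (if i = 1 then coord v 3 - coord v 2 else coord v 3)"
| "coweight g i v = (\<Sum>k=1..i. coord v k)"

lemma coweight_add: "coweight g i (u + v) = coweight g i u + coweight g i v"
  by (cases g) (auto simp: lookup_add sum.distrib)

lemma sum_coord_eps: "(\<Sum>k=1..i. coord (\<epsilon> j) k) = (if 1 \<le> j \<and> j \<le> i then 1 else 0)"
  unfolding coord_eps by (subst sum.delta') auto

lemma coweight_simple_root:
  assumes "valid_type g" "i \<in> {1..rank g}" "j \<in> {1..rank g}"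
  shows "coweight g i (simple_root g j) = 0 \<longleftrightarrow> i \<noteq> j"
  using assms
  by (cases g) (auto simp: coord_simps sum.distrib sum_subtractf sum_coord_eps[unfolded coord_eps]
      sum_coord_eps[unfolded coord_eps One_nat_def] simp flip: sum_distrib_left)

text \<open>Linear independence of the simple roots, in the form in which it makes \<open>exp_neg\<close> well
  defined: pairing with \<open>coweight\<close> recovers all multiplicities.\<close>

lemma Q_plus_sum_inj:
  assumes g: "valid_type g" and \<beta>: "\<beta> \<in> Q_plus g" and \<gamma>: "\<gamma> \<in> Q_plus g" and eq: "\<Sum>\<^sub># \<beta> = \<Sum>\<^sub># \<gamma>"
  shows "\<beta> = \<gamma>"
proof (rule multiset_eqI)
  fix a
  show "count \<beta> a = count \<gamma> a"
  proof (cases "a \<in> simple_roots g")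
    case True
    then obtain i where i: "i \<in> {1..rank g}" "a = simple_root g i" by (auto simp: simple_roots_def)
    have zero: "coweight g i 0 = 0" using coweight_add[of g i 0 0] by simp
    have other: "coweight g i b = 0" if "b \<in> simple_roots g" "b \<noteq> a" for b
      using that coweight_simple_root[OF g i(1)] i by (auto simp: simple_roots_def)
    have "coweight g i (\<Sum>\<^sub># \<delta>) = int (count \<delta> a) * coweight g i a" if "\<delta> \<in> Q_plus g" for \<delta>
      using that
    proof (induction \<delta>)
      case (add b \<delta>)
      then have "\<delta> \<in> Q_plus g" "b \<in> simple_roots g" by (auto simp: Q_plus_def)
      with add.IH other[of b] show ?case by (auto simp: coweight_add algebra_simps)
    qed (simp add: zero)
    then have "int (count \<beta> a) * coweight g i a = int (count \<gamma> a) * coweight g i a"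
      using \<beta> \<gamma> eq by metis
    moreover have "coweight g i a \<noteq> 0" using coweight_simple_root[OF g i(1) i(1)] i(2) by simp
    ultimately show ?thesis by simp
  next
    case False
    then show ?thesis using \<beta> \<gamma> by (metis Q_plus_def mem_Collect_eq not_in_iff subsetD)
  qed
qed

definition root_cone :: "lie_type \<Rightarrow> weight set" where
  "root_cone g = sum_mset ` Q_plus g"

lemma root_cone_0: "0 \<in> root_cone g"
  unfolding root_cone_def by (rule image_eqI[of _ _ "{#}"]) (auto simp: Q_plus_def)

lemma root_cone_add: "u \<in> root_cone g \<Longrightarrow> v \<in> root_cone g \<Longrightarrow> u + v \<in> root_cone g"
proof -
  assume "u \<in> root_cone g" "v \<in> root_cone g"
  then obtain \<beta> \<gamma> where "\<beta> \<in> Q_plus g" "\<gamma> \<in> Q_plus g" "u = \<Sum>\<^sub># \<beta>" "v = \<Sum>\<^sub># \<gamma>"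
    by (auto simp: root_cone_def)
  then show ?thesis
    unfolding root_cone_def by (intro image_eqI[of _ _ "\<beta> + \<gamma>"]) (auto simp: Q_plus_def)
qed

lemma simple_root_in_root_cone: "i \<in> {1..rank g} \<Longrightarrow> simple_root g i \<in> root_cone g"
  unfolding root_cone_def
  by (rule image_eqI[of _ _ "{#simple_root g i#}"]) (auto simp: Q_plus_def simple_roots_def)

text \<open>The difference telescopes into consecutive simple roots. All other positive roots of classical
  type reduce to such differences and the last simple root.\<close>

lemma eps_diff_in_root_cone:
  assumes "g \<noteq> TypeG2" "1 \<le> i" "i \<le> j" "j \<le> dim g"
  shows "\<epsilon> i - \<epsilon> j \<in> root_cone g"
  using assms(3,4)
proof (induction j rule: dec_induct)
  case base
  show ?case by (simp add: root_cone_0)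
next
  case (step j)
  have "simple_root g j = \<epsilon> j - \<epsilon> (j + 1)" "j \<in> {1..rank g}"
    using assms(1,2) step by (cases g; simp)+
  then have "\<epsilon> j - \<epsilon> (Suc j) \<in> root_cone g" using simple_root_in_root_cone by fastforce
  then have "(\<epsilon> i - \<epsilon> j) + (\<epsilon> j - \<epsilon> (Suc j)) \<in> root_cone g"
    using step by (intro root_cone_add) auto
  then show ?case by simp
qed

lemma pos_roots_subset_root_cone:
  assumes "valid_type g"
  shows "pos_roots g \<subseteq> root_cone g"
proof (cases g)
  case (TypeA n)
  then show ?thesis using eps_diff_in_root_cone[of g] by auto
next
  case (TypeB n)
  have eps: "\<epsilon> i \<in> root_cone g" if "1 \<le> i" "i \<le> n" for i
    using root_cone_add[OF eps_diff_in_root_cone[of g i n] simple_root_in_root_cone[of n g]] that TypeB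
    by simp
  then have "\<epsilon> i + \<epsilon> j \<in> root_cone g" if "1 \<le> i" "i < j" "j \<le> n" for i j
    using that by (intro root_cone_add) auto
  then show ?thesis using eps eps_diff_in_root_cone[of g] TypeB by auto
next
  case (TypeC n)
  have "\<epsilon> i + \<epsilon> j \<in> root_cone g" if "1 \<le> i" "1 \<le> j" "i \<le> n" "j \<le> n" for i j
  proof -
    have "(\<epsilon> i - \<epsilon> n) + (\<epsilon> j - \<epsilon> n) + simple_root g n \<in> root_cone g"
      using that TypeC by (intro root_cone_add eps_diff_in_root_cone simple_root_in_root_cone) auto
    moreover have "(\<epsilon> i - \<epsilon> n) + (\<epsilon> j - \<epsilon> n) + simple_root g n = \<epsilon> i + \<epsilon> j"
      unfolding TypeC simple_root.simps if_P[OF refl] by (simp only: algebra_simps)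
    ultimately show ?thesis by simp
  qed
  from this this[of i i for i] show ?thesis
    using eps_diff_in_root_cone[of g] TypeC by (auto simp del: mult_2)
next
  case (TypeD n)
  have "\<epsilon> i + \<epsilon> j \<in> root_cone g" if "1 \<le> i" "i < j" "j \<le> n" for i j
  proof -
    have "(\<epsilon> i - \<epsilon> (n - 1)) + (\<epsilon> j - \<epsilon> n) + simple_root g n \<in> root_cone g"
      using that TypeD assms by (intro root_cone_add eps_diff_in_root_cone simple_root_in_root_cone) auto
    then show ?thesis using TypeD by (simp add: algebra_simps)
  qed
  then show ?thesis using eps_diff_in_root_cone[of g] TypeD by auto
next
  case TypeG2
  have a: "simple_root TypeG2 1 \<in> root_cone g" "simple_root TypeG2 2 \<in> root_cone g"
    unfolding TypeG2 by (rule simple_root_in_root_cone; simp)+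
  show ?thesis
    unfolding TypeG2 pos_roots.simps Let_def insert_subset
    by (intro conjI empty_subsetI root_cone_add a[unfolded TypeG2])
qed

lemma zero_notin_pos_roots:
  assumes "valid_type g"
  shows "0 \<notin> pos_roots g"
proof (cases "g = TypeG2")
  case True
  \<comment> \<open>The functional that separates the six positive roots does not vanish on any of them.\<close>
  have "4 * coord \<alpha> 1 + coord \<alpha> 2 \<noteq> 0" if "\<alpha> \<in> pos_roots TypeG2" for \<alpha>
    using that unfolding pos_roots_eq_box_roots[of TypeG2, simplified] boxes_G2
    by (auto simp: box_root_def coord_simps)
  from this[of 0] show ?thesis using True by auto
next
  case False
  have "box_root g i x \<noteq> 0" if "i \<in> {1..num_rows g}" "x \<in> root_letters g i" for i x
    using coord_box_root(1)[OF False _ _ that(2)] that(1) by force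
  then show ?thesis unfolding pos_roots_eq_box_roots[OF assms] by force
qed

lemma finite_pos_roots:
  assumes "valid_type g"
  shows "finite (pos_roots g)"
proof -
  have "finite (letters g)" by (cases g) auto
  then have "finite (root_letters g i)" for i
    by (rule finite_subset[rotated]) (auto simp: root_letters_def row_letters_def)
  then show ?thesis unfolding pos_roots_eq_box_roots[OF assms] by auto
qed

lemma simple_roots_subset_pos_roots:
  assumes "valid_type g"
  shows "simple_roots g \<subseteq> pos_roots g"
proof -
  have eps: "\<epsilon> i - \<epsilon> (i + 1) \<in> {\<epsilon> i - \<epsilon> j | i j. 1 \<le> i \<and> i < j \<and> j \<le> n}" if "1 \<le> i" "i < n" for i n
    using that by (intro CollectI exI[of _ i] exI[of _ "i + 1"]) simp
  have "simple_root g i \<in> pos_roots g" if "i \<in> {1..rank g}" for i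
  proof (cases g)
    case (TypeA n)
    then have "1 \<le> i" "i < n" using that by auto
    then show ?thesis using eps[of i n] TypeA by simp
  next
    case (TypeB n)
    then show ?thesis using that eps[of i n] by (cases "i = n") auto
  next
    case (TypeC n)
    then show ?thesis using that eps[of i n] by (cases "i = n") auto
  next
    case (TypeD n)
    show ?thesis
    proof (cases "i = n")
      case True
      have "1 \<le> n - 1 \<and> n - 1 < n \<and> n \<le> n" using assms TypeD by auto
      then show ?thesis unfolding TypeD True pos_roots.simps simple_root.simps by auto
    next
      case False
      then show ?thesis using TypeD that eps[of i n] by simp
    qed
  next
    case TypeG2
    then have "1 \<le> i" "i \<le> 2" using that by simp_all
    then consider "i = 1" | "i = 2" by linarith
    then show ?thesis by cases (simp_all add: TypeG2 Let_def)
  qed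
  then show ?thesis by (auto simp: simple_roots_def)
qed


section \<open>Characters as generating series\<close>

text \<open>This is the exponent that occurs in \<open>exp_neg\<close>.\<close>

definition expansion :: "lie_type \<Rightarrow> weight \<Rightarrow> weight multiset" where
  "expansion g v = (THE \<beta>. \<beta> \<in> Q_plus g \<and> \<Sum>\<^sub># \<beta> = v)"

abbreviation expand :: "lie_type \<Rightarrow> weight multiset \<Rightarrow> weight multiset" where
  "expand g m \<equiv> \<Sum>\<^sub># (image_mset (expansion g) m)"

lemma expansion_eq:
  "valid_type g \<Longrightarrow> \<beta> \<in> Q_plus g \<Longrightarrow> \<Sum>\<^sub># \<beta> = v \<Longrightarrow> expansion g v = \<beta>"
  unfolding expansion_def using Q_plus_sum_inj by blast

lemma expansion_pos_root:
  assumes "valid_type g" "\<alpha> \<in> pos_roots g"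
  shows "expansion g \<alpha> \<in> Q_plus g" "\<Sum>\<^sub># (expansion g \<alpha>) = \<alpha>" "expansion g \<alpha> \<noteq> {#}"
proof -
  obtain \<beta> where \<beta>: "\<beta> \<in> Q_plus g" "\<Sum>\<^sub># \<beta> = \<alpha>"
    using pos_roots_subset_root_cone[OF assms(1)] assms(2) by (auto simp: root_cone_def)
  then have "expansion g \<alpha> = \<beta>" by (rule expansion_eq[OF assms(1)])
  with \<beta> show "expansion g \<alpha> \<in> Q_plus g" "\<Sum>\<^sub># (expansion g \<alpha>) = \<alpha>" by simp_all
  then show "expansion g \<alpha> \<noteq> {#}"
    using zero_notin_pos_roots[OF assms(1)] assms(2) by auto
qed

lemma expand_pos_roots:
  assumes "valid_type g" "set_mset m \<subseteq> pos_roots g"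
  shows "expand g m \<in> Q_plus g \<and> \<Sum>\<^sub># (expand g m) = \<Sum>\<^sub># m"
  using assms(2)
proof (induction m)
  case (add \<alpha> m)
  then show ?case using expansion_pos_root[OF assms(1), of \<alpha>] by (auto simp: Q_plus_def)
qed (simp add: Q_plus_def)

lemma exp_neg_eq: "exp_neg g v = monomial_ms (expansion g v) 1"
  by (simp add: exp_neg_def expansion_def)

lemma t_product_eq:
  assumes "valid_type g" "R \<subseteq> pos_roots g"
  shows "t_product g R = multiset_series (expansion g) {m. set_mset m \<subseteq> R}"
proof -
  have "finite R" using assms finite_pos_roots finite_subset by blast
  then have "(\<Prod>\<alpha>\<in>R. inverse_ms (1 - monomial_ms (expansion g \<alpha>) [:0, 1:])) =
      multiset_series (expansion g) {m. set_mset m \<subseteq> R}"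
    using assms(2) expansion_pos_root(3)[OF assms(1)] by (intro prod_inverse_eq_multiset_series) auto
  then show ?thesis
    by (simp add: t_product_def exp_neg_eq t_series_def monomial_ms_times_monomial_ms)
qed

text \<open>For tableaux, \<open>wt\<close> is minus the sum of the roots of \<open>\<Xi>\<close>, and by the uniqueness of expansions
  comparing weights amounts to comparing exponents. So the character depends on the
  multisegments only, and it counts them by size and exponent.\<close>

lemma t_character_eq:
  assumes g: "valid_type g" and X: "X \<subseteq> T_inf g"
  shows "t_character g X = multiset_series (expansion g) (\<Xi> g ` X)"
proof (rule mseries_eqI)
  fix \<beta>
  have roots: "set_mset (\<Xi> g T) \<subseteq> pos_roots g" if "T \<in> X" for T
    using bij_betwE[OF bij_betw_Xi[OF g]] X that by blast
  have inj: "inj_on (\<Xi> g) X"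
    using bij_betw_imp_inj_on[OF bij_betw_Xi[OF g]] X by (rule inj_on_subset)
  show "coeff_ms (t_character g X) \<beta> = coeff_ms (multiset_series (expansion g) (\<Xi> g ` X)) \<beta>"
  proof (cases "\<beta> \<in> Q_plus g")
    case True
    have wt: "wt g T = - \<Sum>\<^sub># \<beta> \<longleftrightarrow> expand g (\<Xi> g T) = \<beta>" if "T \<in> X" for T
    proof -
      have "wt g T = - \<Sum>\<^sub># \<beta> \<longleftrightarrow> \<Sum>\<^sub># (expand g (\<Xi> g T)) = \<Sum>\<^sub># \<beta>"
        unfolding wt_eq neg_equal_iff_equal using expand_pos_roots[OF g roots[OF that]] by simp
      also have "\<dots> \<longleftrightarrow> expand g (\<Xi> g T) = \<beta>"
        using expand_pos_roots[OF g roots[OF that]] Q_plus_sum_inj[OF g _ True] by blast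
      finally show ?thesis .
    qed
    have "{m. m \<in> \<Xi> g ` X \<and> expand g m = \<beta>} = \<Xi> g ` {T. T \<in> X \<and> wt g T = - \<Sum>\<^sub># \<beta>}"
      using wt by blast
    moreover have "inj_on (\<Xi> g) {T. T \<in> X \<and> wt g T = - \<Sum>\<^sub># \<beta>}"
      using inj by (rule inj_on_subset) auto
    ultimately show ?thesis
      using True by (simp add: t_character_def Q_plus_series_def t_mult_def coeff_multiset_series
          sum.reindex tab_size_def)
  next
    case False
    then have empty: "{m. m \<in> \<Xi> g ` X \<and> expand g m = \<beta>} = {}"
      using expand_pos_roots[OF g roots] by blast
    show ?thesis
      unfolding coeff_multiset_series empty using False by (simp add: t_character_def Q_plus_series_def)
  qed
qed


section \<open>Connected components and their sources\<close>

text \<open>The nonsimple part of the multisegment, which is the invariant that separates the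
  components.\<close>

definition core :: "lie_type \<Rightarrow> tableau \<Rightarrow> weight multiset" where
  "core g T = filter_mset (\<lambda>\<alpha>. \<alpha> \<notin> simple_roots g) (\<Xi> g T)"

lemma ex_T_inf:
  assumes "valid_type g" "set_mset m \<subseteq> pos_roots g"
  shows "\<exists>T\<in>T_inf g. \<Xi> g T = m"
  using bij_betw_imp_surj_on[OF bij_betw_Xi[OF assms(1)]] assms(2) by (metis (no_types, lifting) imageE mem_Collect_eq)

lemma Xi_inject:
  "valid_type g \<Longrightarrow> T \<in> T_inf g \<Longrightarrow> T' \<in> T_inf g \<Longrightarrow> \<Xi> g T = \<Xi> g T' \<Longrightarrow> T = T'"
  using bij_betw_imp_inj_on[OF bij_betw_Xi] by (metis inj_onD)

lemma set_Xi: "valid_type g \<Longrightarrow> T \<in> T_inf g \<Longrightarrow> set_mset (\<Xi> g T) \<subseteq> pos_roots g"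
  using bij_betwE[OF bij_betw_Xi] by blast

lemma F_eqI:
  assumes "valid_type g" "T' \<in> T_inf g" "\<Xi> g T' = add_mset (simple_root g i) (\<Xi> g T)"
  shows "F g i T = T'"
  unfolding F_def using assms Xi_inject[OF assms(1)] by (intro the_equality) auto

lemma F_props:
  assumes g: "valid_type g" and "T \<in> T_inf g" "i \<in> {1..rank g}"
  shows "F g i T \<in> T_inf g" "\<Xi> g (F g i T) = add_mset (simple_root g i) (\<Xi> g T)"
proof -
  have "simple_root g i \<in> pos_roots g"
    using simple_roots_subset_pos_roots[OF g] assms(3) by (auto simp: simple_roots_def)
  then obtain T' where "T' \<in> T_inf g" "\<Xi> g T' = add_mset (simple_root g i) (\<Xi> g T)"
    using ex_T_inf[OF g, of "add_mset (simple_root g i) (\<Xi> g T)"] set_Xi[OF g assms(2)] by auto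
  then show "F g i T \<in> T_inf g" "\<Xi> g (F g i T) = add_mset (simple_root g i) (\<Xi> g T)"
    using F_eqI[OF g] by simp_all
qed

lemma ST_inf_iff:
  assumes g: "valid_type g"
  shows "S \<in> ST_inf g \<longleftrightarrow> S \<in> T_inf g \<and> set_mset (\<Xi> g S) \<inter> simple_roots g = {}"
proof -
  have "(\<exists>T'\<in>T_inf g. F g i T' = S) \<longleftrightarrow> simple_root g i \<in># \<Xi> g S"
    if S: "S \<in> T_inf g" and i: "i \<in> {1..rank g}" for i
  proof
    assume "\<exists>T'\<in>T_inf g. F g i T' = S"
    then show "simple_root g i \<in># \<Xi> g S" using F_props(2)[OF g _ i] by force
  next
    assume "simple_root g i \<in># \<Xi> g S"
    then obtain m where m: "\<Xi> g S = add_mset (simple_root g i) m" by (meson multi_member_split)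
    then obtain T' where "T' \<in> T_inf g" "\<Xi> g T' = m"
      using ex_T_inf[OF g, of m] set_Xi[OF g S] by auto
    then show "\<exists>T'\<in>T_inf g. F g i T' = S" using F_eqI[OF g S] m by auto
  qed
  then have "E g i S = None \<longleftrightarrow> simple_root g i \<notin># \<Xi> g S" if "S \<in> T_inf g" "i \<in> {1..rank g}" for i
    using that by (simp add: E_def)
  then show ?thesis unfolding ST_inf_def simple_roots_def by blast
qed

lemma core_ST_inf:
  assumes "valid_type g" "S \<in> ST_inf g"
  shows "core g S = \<Xi> g S"
  using assms by (auto simp: core_def ST_inf_iff filter_mset_eq_conv)

lemma Xi_image_ST_inf:
  assumes g: "valid_type g"
  shows "\<Xi> g ` ST_inf g = {m. set_mset m \<subseteq> pos_roots g - simple_roots g}"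
proof
  show "\<Xi> g ` ST_inf g \<subseteq> {m. set_mset m \<subseteq> pos_roots g - simple_roots g}"
    using set_Xi[OF g] by (fastforce simp: ST_inf_iff[OF g])
  show "{m. set_mset m \<subseteq> pos_roots g - simple_roots g} \<subseteq> \<Xi> g ` ST_inf g"
  proof
    fix m assume "m \<in> {m. set_mset m \<subseteq> pos_roots g - simple_roots g}"
    then have m: "set_mset m \<subseteq> pos_roots g" "set_mset m \<inter> simple_roots g = {}" by auto
    then obtain T where "T \<in> T_inf g" "\<Xi> g T = m" using ex_T_inf[OF g] by blast
    with m show "m \<in> \<Xi> g ` ST_inf g" by (auto simp: ST_inf_iff[OF g])
  qed
qed

lemma ex_source:
  assumes g: "valid_type g" and T: "T \<in> T_inf g"
  shows "\<exists>S\<in>ST_inf g. \<Xi> g S = core g T"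
proof -
  have "core g T \<in> \<Xi> g ` ST_inf g"
    using set_Xi[OF g T] by (auto simp: Xi_image_ST_inf[OF g] core_def)
  then show ?thesis by auto
qed

lemma B_edges_reach:
  assumes g: "valid_type g" and "set_mset m \<subseteq> simple_roots g"
    and "T \<in> T_inf g" "T' \<in> T_inf g" "\<Xi> g T' = \<Xi> g T + m"
  shows "(T, T') \<in> (B_edges g)\<^sup>*"
  using assms(2-)
proof (induction m arbitrary: T')
  case empty
  then have "T = T'" by (intro Xi_inject[OF g]) simp_all
  then show ?case by simp
next
  case (add a m)
  obtain i where i: "i \<in> {1..rank g}" "a = simple_root g i"
    using add.prems(1) by (auto simp: simple_roots_def)
  obtain T1 where T1: "T1 \<in> T_inf g" "\<Xi> g T1 = \<Xi> g T + m"
    using ex_T_inf[OF g, of "\<Xi> g T + m"] set_Xi[OF g add.prems(3)] add.prems(4) by auto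
  have "(T, T1) \<in> (B_edges g)\<^sup>*" using add T1 by simp
  moreover have "F g i T1 = T'" using add.prems T1 i by (intro F_eqI[OF g]) auto
  then have "(T1, T') \<in> B_edges g" using T1 i by (auto simp: B_edges_def)
  ultimately show ?case by (rule rtrancl_into_rtrancl)
qed

text \<open>An edge changes only the simple part. Conversely both tableaux can be reached from the
  one whose multisegment is the common core, by adding simple roots one at a time.\<close>

lemma B_connected_iff:
  assumes g: "valid_type g"
  shows "(T, T') \<in> B_connected g \<longleftrightarrow> T \<in> T_inf g \<and> T' \<in> T_inf g \<and> core g T = core g T'"
proof
  assume conn: "(T, T') \<in> B_connected g"
  have edge: "core g T1 = core g T2" if "(T1, T2) \<in> B_edges g" for T1 T2
    using that F_props(2)[OF g] by (auto simp: B_edges_def core_def simple_roots_def)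
  have "(T, T') \<in> (B_edges g \<union> (B_edges g)\<inverse>)\<^sup>*" using conn by (simp add: B_connected_def)
  then have "core g T = core g T'"
    by (induction rule: rtrancl_induct) (use edge in auto)
  with conn show "T \<in> T_inf g \<and> T' \<in> T_inf g \<and> core g T = core g T'"
    by (auto simp: B_connected_def)
next
  assume *: "T \<in> T_inf g \<and> T' \<in> T_inf g \<and> core g T = core g T'"
  then have "\<exists>S\<in>ST_inf g. \<Xi> g S = core g T" by (intro ex_source[OF g]) simp
  then obtain S where S: "S \<in> T_inf g" "\<Xi> g S = core g T"
    unfolding ST_inf_iff[OF g] Bex_def by blast
  have reach: "(S, U) \<in> (B_edges g)\<^sup>*" if "U \<in> T_inf g" "core g U = core g T" for U
  proof (rule B_edges_reach[OF g _ S(1) that(1)])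
    show "set_mset (filter_mset (\<lambda>\<alpha>. \<alpha> \<in> simple_roots g) (\<Xi> g U)) \<subseteq> simple_roots g" by auto
    show "\<Xi> g U = \<Xi> g S + filter_mset (\<lambda>\<alpha>. \<alpha> \<in> simple_roots g) (\<Xi> g U)"
      unfolding S(2) that(2)[symmetric] unfolding core_def by (simp add: add.commute)
  qed
  have "(T, S) \<in> ((B_edges g)\<inverse>)\<^sup>*" using reach[of T] * by (simp add: rtrancl_converse)
  moreover have "(S, T') \<in> (B_edges g)\<^sup>*" using reach[of T'] * by simp
  ultimately have "(T, T') \<in> (B_edges g \<union> (B_edges g)\<inverse>)\<^sup>*"
    by (meson in_rtrancl_UnI rtrancl_trans)
  with * show "(T, T') \<in> B_connected g" by (simp add: B_connected_def)
qed

lemma equiv_B_connected: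
  assumes "valid_type g"
  shows "equiv (T_inf g) (B_connected g)"
  by (auto intro!: equivI refl_onI symI transI simp: B_connected_iff[OF assms])

lemma B_component_source:
  assumes g: "valid_type g" and S: "S \<in> ST_inf g"
  shows "B_component g S = {T \<in> T_inf g. core g T = \<Xi> g S}"
  using S core_ST_inf[OF g S]
  by (auto simp: B_component_def B_connected_iff[OF g] ST_inf_iff[OF g])

text \<open>A component is a translate of the free monoid on the simple roots, which is why its character
  is a shifted product over the simple roots.\<close>

lemma Xi_image_B_component:
  assumes g: "valid_type g" and S: "S \<in> ST_inf g"
  shows "\<Xi> g ` B_component g S = (+) (\<Xi> g S) ` {m. set_mset m \<subseteq> simple_roots g}"
proof (intro equalityI subsetI)
  fix x assume "x \<in> \<Xi> g ` B_component g S"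
  then obtain T where T: "x = \<Xi> g T" "core g T = \<Xi> g S"
    by (auto simp: B_component_source[OF g S])
  have "x = \<Xi> g S + filter_mset (\<lambda>\<alpha>. \<alpha> \<in> simple_roots g) (\<Xi> g T)"
    unfolding T(1) T(2)[symmetric] unfolding core_def by (simp add: add.commute)
  then show "x \<in> (+) (\<Xi> g S) ` {m. set_mset m \<subseteq> simple_roots g}" by auto
next
  fix x assume "x \<in> (+) (\<Xi> g S) ` {m. set_mset m \<subseteq> simple_roots g}"
  then obtain m where m: "x = \<Xi> g S + m" "set_mset m \<subseteq> simple_roots g" by auto
  have "S \<in> T_inf g" using S by (simp add: ST_inf_iff[OF g])
  then obtain T where T: "T \<in> T_inf g" "\<Xi> g T = x"
    using ex_T_inf[OF g, of x] set_Xi[OF g] m simple_roots_subset_pos_roots[OF g] by fastforce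
  have "filter_mset (\<lambda>\<alpha>. \<alpha> \<notin> simple_roots g) m = {#}"
    using m(2) by (auto simp: filter_mset_eq_conv)
  then have "core g T = \<Xi> g S"
    using core_ST_inf[OF g S] by (simp add: core_def T(2) m(1))
  with T show "x \<in> \<Xi> g ` B_component g S" by (auto simp: B_component_source[OF g S])
qed

lemma bij_betw_B_component:
  assumes g: "valid_type g"
  shows "bij_betw (B_component g) (ST_inf g) (B_components g)"
proof (rule bij_betw_imageI)
  show "inj_on (B_component g) (ST_inf g)"
  proof (rule inj_onI)
    fix S S' assume S: "S \<in> ST_inf g" "S' \<in> ST_inf g" "B_component g S = B_component g S'"
    then have "S \<in> B_component g S'"
      using core_ST_inf[OF g S(1)] by (auto simp: B_component_source[OF g] ST_inf_iff[OF g])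
    then show "S = S'"
      using S core_ST_inf[OF g S(1)] Xi_inject[OF g]
      by (auto simp: B_component_source[OF g] ST_inf_iff[OF g])
  qed
  show "B_component g ` ST_inf g = B_components g"
  proof
    show "B_component g ` ST_inf g \<subseteq> B_components g"
      by (auto simp: B_components_def B_component_def ST_inf_def intro: quotientI)
    show "B_components g \<subseteq> B_component g ` ST_inf g"
    proof
      fix C assume "C \<in> B_components g"
      then obtain T where T: "T \<in> T_inf g" "C = B_connected g `` {T}"
        by (auto simp: B_components_def elim: quotientE)
      obtain S where S: "S \<in> ST_inf g" "\<Xi> g S = core g T" using ex_source[OF g T(1)] by blast
      have "C = B_component g S"
        using T S by (auto simp: B_component_source[OF g] B_connected_iff[OF g])
      with S show "C \<in> B_component g ` ST_inf g" by blast
    qed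
  qed
qed

lemma B_component_Int_ST_inf:
  assumes g: "valid_type g" and S: "S \<in> ST_inf g"
  shows "B_component g S \<inter> ST_inf g = {S}"
proof (intro equalityI subsetI)
  fix T assume T: "T \<in> B_component g S \<inter> ST_inf g"
  then have "\<Xi> g T = \<Xi> g S"
    using core_ST_inf[OF g, of T] by (auto simp: B_component_source[OF g S])
  then show "T \<in> {S}" using T S Xi_inject[OF g, of T S] by (auto simp: ST_inf_iff[OF g])
next
  fix T assume "T \<in> {S}"
  then show "T \<in> B_component g S \<inter> ST_inf g"
    using S core_ST_inf[OF g S] by (auto simp: B_component_source[OF g S] ST_inf_iff[OF g])
qed


section \<open>The atomic decomposition\<close>

lemma t_character_B_component:
  assumes g: "valid_type g" and S: "S \<in> ST_inf g"
  shows "t_character g (B_component g S) =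
    t_series ^ tab_size g S * exp_neg g (- wt g S) * t_product g (simple_roots g)"
proof -
  have roots: "set_mset (\<Xi> g S) \<subseteq> pos_roots g" using S set_Xi[OF g] by (simp add: ST_inf_iff[OF g])
  have "expansion g (- wt g S) = expand g (\<Xi> g S)"
    using expand_pos_roots[OF g roots] by (intro expansion_eq[OF g]) (auto simp: wt_eq)
  \<comment> \<open>The factor in front is the monomial by which translation by \<open>\<Xi> S\<close> multiplies a series.\<close>
  then have prefactor: "t_series ^ tab_size g S * exp_neg g (- wt g S) =
      monomial_ms (expand g (\<Xi> g S)) ([:0, 1:] ^ size (\<Xi> g S))"
    by (simp add: t_series_power exp_neg_eq monomial_ms_times_monomial_ms tab_size_def)
  have "B_component g S \<subseteq> T_inf g" by (auto simp: B_component_source[OF g S])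
  then show ?thesis
    by (simp only: t_character_eq[OF g] Xi_image_B_component[OF g S] multiset_series_shift prefactor
        t_product_eq[OF g simple_roots_subset_pos_roots[OF g]])
qed

text \<open>The sources are the multisegments over the nonsimple positive roots, whose generating
  series defines \<open>M\<^sub>t\<close>.\<close>

lemma t_character_ST_inf:
  assumes g: "valid_type g"
  shows "t_character g (ST_inf g) = t_product g (pos_roots g - simple_roots g)"
proof -
  have "ST_inf g \<subseteq> T_inf g" by (auto simp: ST_inf_def)
  then show ?thesis
    by (simp only: t_character_eq[OF g] t_product_eq[OF g Diff_subset] Xi_image_ST_inf[OF g])
qed

theorem corollary3p4:
  fixes g :: lie_type
  assumes "valid_type g"
  shows
    "partition_on (T_inf g) (B_components g)
     \<and> bij_betw (B_component g) (ST_inf g) (B_components g)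
     \<and> (\<forall>S\<in>ST_inf g. B_component g S \<inter> ST_inf g = {S})
     \<and> (\<forall>S\<in>ST_inf g. t_character g (B_component g S) =
          t_series ^ tab_size g S * exp_neg g (- wt g S) * t_product g (simple_roots g))
     \<and> (\<Prod>\<alpha>\<in>pos_roots g. inverse_ms (1 - t_series * exp_neg g \<alpha>)) =
          Q_plus_series g (M_t g) *
          (\<Prod>\<alpha>\<in>simple_roots g. inverse_ms (1 - t_series * exp_neg g \<alpha>))
     \<and> (\<forall>\<beta>\<in>Q_plus g. M_t g \<beta> = 
          (\<Sum>S | S \<in> ST_inf g \<and> wt g S = - \<Sum>\<^sub># \<beta>. [:0, 1:] ^ tab_size g S))"
proof (intro conjI ballI)
  note g = assms
  show "partition_on (T_inf g) (B_components g)"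
    unfolding B_components_def by (rule partition_on_quotient[OF equiv_B_connected[OF g]])
  show "bij_betw (B_component g) (ST_inf g) (B_components g)"
    by (rule bij_betw_B_component[OF g])
  show "B_component g S \<inter> ST_inf g = {S}" if "S \<in> ST_inf g" for S
    using g that by (rule B_component_Int_ST_inf)
  show "t_character g (B_component g S) =
      t_series ^ tab_size g S * exp_neg g (- wt g S) * t_product g (simple_roots g)"
    if "S \<in> ST_inf g" for S
    using g that by (rule t_character_B_component)
  have M: "M_t g \<beta> = coeff_ms (t_character g (ST_inf g)) \<beta>" for \<beta>
    by (simp add: M_t_def t_character_ST_inf[OF g])
  \<comment> \<open>A character has coefficients only at exponents in \<open>Q\<^sup>+\<close>, so that nothing is lost when
    \<open>M\<^sub>t\<close> is restricted to \<open>Q\<^sup>+\<close>.\<close>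
  have "Q_plus_series g (M_t g) = t_product g (pos_roots g - simple_roots g)"
    unfolding t_character_ST_inf[OF g, symmetric]
    by (rule mseries_eqI) (simp add: M Q_plus_series_def t_character_def)
  then show "(\<Prod>\<alpha>\<in>pos_roots g. inverse_ms (1 - t_series * exp_neg g \<alpha>)) =
      Q_plus_series g (M_t g) * (\<Prod>\<alpha>\<in>simple_roots g. inverse_ms (1 - t_series * exp_neg g \<alpha>))"
    unfolding t_product_def
    using prod.subset_diff[OF simple_roots_subset_pos_roots[OF g] finite_pos_roots[OF g],
        of "\<lambda>\<alpha>. inverse_ms (1 - t_series * exp_neg g \<alpha>)"] by simp
  show "M_t g \<beta> = (\<Sum>S | S \<in> ST_inf g \<and> wt g S = - \<Sum>\<^sub># \<beta>. [:0, 1:] ^ tab_size g S)"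
    if "\<beta> \<in> Q_plus g" for \<beta>
    using that by (simp add: M t_character_def Q_plus_series_def t_mult_def)
qed

end
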